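(* Let $\tau>0$, $\eta>0$, $\theta_Y\in[0,\pi]$. Let $S^0$ be an initial polygonal surface and, for $m\ge0$, let $(\mathbf X^{m+1},\mathcal H^{m+1})\in\mathbb X^m\times\mathbb M^m$ be the numerical solution of the scheme $$\Bigl(\tfrac{\mathbf X^{m+1}-\mathbf X^m}{\tau},\mathbf n^m\psi^h\Bigr)^h_{S^m}+\bigl(\nabla_s\mathcal H^{m+1},\nabla_s\psi^h\bigr)_{S^m}=0\qquad\forall\,\psi^h\in\mathbb M^m,$$ $$\bigl(\mathcal H^{m+1}\mathbf n^m,\boldsymbol g^h\bigr)^h_{S^m}-\bigl(\nabla_s\mathbf X^{m+1},\nabla_s\boldsymbol g^h\bigr)_{S^m}+\cos\theta_Y\bigl(\mathbf n_\Gamma^{m+\frac12},\boldsymbol g^h\bigr)_{\Gamma^m}-\frac1{\eta\tau}\bigl((\mathbf X_\Gamma^{m+1}-\mathbf X_\Gamma^m)\cdot\mathbf n_\Gamma^m,\boldsymbol g^h\cdot\mathbf n_\Gamma^m\bigr)_{\Gamma^m}=0\qquad\forall\,\boldsymbol g^h\in\mathbb X^m,$$ with $S^{m+1}:=\mathbf X^{m+1}(S^m)$. Put $W^m:=|S^m|-\cos\theta_Y\,|S_1^m|$. Then the energy is decreasing during the evolution: $$W^{m+1}\le W^m\le W^0=|S^0|-\cos\theta_Y|S_1^0|,\qquad m\ge0.$$ Moreover, for all $m\ge0$, $$\sum_{l=1}^{m+1}\bigl\|\nabla_s\mathcal H^l\bigr\|^2_{S^{l-1}}+\frac1\eta\sum_{l=1}^{m+1}\Bigl\|\Bigl(\frac{\mathbf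 X_\Gamma^l-\mathbf X_\Gamma^{l-1}}{\tau}\Bigr)\cdot\mathbf n_\Gamma^{l-1}\Bigr\|^2_{\Gamma^{l-1}}\le\frac{W^0-W^{m+1}}{\tau},$$ where $\|\cdot\|_{S^l}$ and $\|\cdot\|_{\Gamma^l}$ are the $L^2$-norms over $S^l$ and $\Gamma^l$.
   Context: Mesh. For each $m\ge0$, $S^m=\bigcup_{j=1}^N\overline{\sigma_j^m}\subset\mathbb R^3$ is a polygonal surface consisting of $N$ mutually disjoint non-degenerate (open) triangles $\sigma_j^m$ with vertices $\mathbf q_{j_1}^m,\mathbf q_{j_2}^m,\mathbf q_{j_3}^m$ (ordered anticlockwise on the outer side of $S^m$), forming a triangulation. Its boundary $\Gamma^m=\bigcup_{j=1}^{N_\Gamma}\overline{l_j^m}$ is a simple closed, positively oriented polygonal curve in the plane $\{x_3=0\}$ with segments $l_j^m=[\mathbf p_{j_1}^m,\mathbf p_{j_2}^m]$. The triangles of $S^{m+1}=\mathbf X^{m+1}(S^m)$ are the images $\mathbf X^{m+1}(\sigma_j^m)$, and $\Gamma^{m+1}=\mathbf X^{m+1}(\Gamma^m)$; the surfaces at all time levels are assumed to be of this type. $|S^m|=\sum_j|\sigma_j^m|$ is the area of $S^m$, and $|S_1^m|$ is the area of the plane region enclosed by $\Gamma^m$. $\mathbf e_z=(0,0,1)^T$. Normals. $\mathbf n^m$ is piecewise constant, equal on $\sigma_j^m$ to $\frac{(\mathbf q_{j_2}^m-\mathbf q_{j_1}^m)\times(\mathbf q_{j_3}^m-\mathbf q_{j_1}^m)}{\|(\mathbf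 q_{j_2}^m-\mathbf q_{j_1}^m)\times(\mathbf q_{j_3}^m-\mathbf q_{j_1}^m)\|}$; $\mathbf n_\Gamma^m$ is equal on $l_j^m$ to $\frac{(\mathbf p_{j_2}^m-\mathbf p_{j_1}^m)\times\mathbf e_z}{\|(\mathbf p_{j_2}^m-\mathbf p_{j_1}^m)\times\mathbf e_z\|}$. Spaces. $\mathbb M^m$ is the space of continuous real functions on $S^m$ that are affine on each $\sigma_j^m$; $\mathbb M_0^m\subset\mathbb M^m$ consists of those vanishing on $\Gamma^m$; $\mathbb X^m=\mathbb M^m\times\mathbb M^m\times\mathbb M^m_0$. In the scheme on $S^m$, $\mathbf X^m\in\mathbb X^m$ is the identity function on $S^m$; $\mathbf X_\Gamma^m,\mathbf X_\Gamma^{m+1}$ are the restrictions of $\mathbf X^m,\mathbf X^{m+1}$ to $\Gamma^m$. Products. $(\cdot,\cdot)_{S^m}$ and $(\cdot,\cdot)_{\Gamma^m}$ are the $L^2$ inner products over $S^m$ (area) and $\Gamma^m$ (arc length), using dot products for vectors and Frobenius products for matrices; $\nabla_s$ is the (piecewise) surface gradient on $S^m$, $\nabla_sf=(\mathbb I-\mathbf n^m\otimes\mathbf n^m)\nabla f$, componentwise for vectors (in $\|\nabla_s\mathcal H^l\|_{S^{l-1}}$ it is taken on $S^{l-1}$). The mass-lumped product is $(f,g)^h_{S^m}=\frac13\sum_{j=1}^N\sum_{k=1}^3|\sigma_j^m|\,f((\mathbf q_{j_k}^m)^-)\cdot g((\mathbf q_{j_k}^m)^-)$, where $f((\mathbf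 q_{j_k}^m)^-)$ is the limit of $f$ at $\mathbf q_{j_k}^m$ from within $\sigma_j^m$. Finally $\mathbf n_\Gamma^{m+\frac12}=\frac12(\partial_s\mathbf X_\Gamma^m+\partial_s\mathbf X_\Gamma^{m+1})\times\mathbf e_z$, with $s$ the arc length parameter of $\Gamma^m$. *)

theory Defs
  imports "HOL-Analysis.Analysis" "HOL-Complex_Analysis.Complex_Analysis"
begin

section \<open>Polygonal surfaces\<close>

text \<open>The triangles and the boundary segments of a mesh are given by their vertices, with labels:
  \<open>tri M j k\<close> (\<open>j\<close> in \<open>{1..n_tri M}\<close>, \<open>k\<close> in \<open>{1, 2, 3}\<close>) is the \<open>k\<close>-th vertex of the \<open>j\<close>-th
  triangle, and \<open>bseg M j k\<close> (\<open>j\<close> in \<open>{1..n_bseg M}\<close>, \<open>k\<close> in \<open>{1, 2}\<close>) is the \<open>k\<close>-th endpoint of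
  the \<open>j\<close>-th boundary segment. Values at other indices are irrelevant.\<close>

record mesh =
  n_tri :: nat
  tri :: "nat \<Rightarrow> nat \<Rightarrow> real^3"
  n_bseg :: nat
  bseg :: "nat \<Rightarrow> nat \<Rightarrow> real^3"

definition e_z :: "real^3" where
  "e_z = vector [0, 0, 1]"

definition closed_tri :: "mesh \<Rightarrow> nat \<Rightarrow> (real^3) set" where
  "closed_tri M j = convex hull {tri M j 1, tri M j 2, tri M j 3}"

definition open_tri :: "mesh \<Rightarrow> nat \<Rightarrow> (real^3) set" where
  "open_tri M j = rel_interior (closed_tri M j)"

definition surf :: "mesh \<Rightarrow> (real^3) set" where
  "surf M = (\<Union>j\<in>{1..n_tri M}. closed_tri M j)"

definition bcurve :: "mesh \<Rightarrow> (real^3) set" where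
  "bcurve M = (\<Union>j\<in>{1..n_bseg M}. closed_segment (bseg M j 1) (bseg M j 2))"

definition tri_edges :: "mesh \<Rightarrow> nat \<Rightarrow> (real^3) set set" where
  "tri_edges M j = {{tri M j 1, tri M j 2}, {tri M j 2, tri M j 3}, {tri M j 3, tri M j 1}}"

definition tri_dir_edges :: "mesh \<Rightarrow> nat \<Rightarrow> ((real^3) \<times> (real^3)) set" where
  "tri_dir_edges M j = {(tri M j 1, tri M j 2), (tri M j 2, tri M j 3), (tri M j 3, tri M j 1)}"

text \<open>Identification of the plane \<open>x\<^sub>3 = 0\<close> with the complex plane.\<close>

definition to_plane :: "real^3 \<Rightarrow> complex" where
  "to_plane x = Complex (x $ 1) (x $ 2)"

fun polyline :: "complex list \<Rightarrow> real \<Rightarrow> complex" where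
  "polyline [] = linepath 0 0"
| "polyline [a] = linepath a a"
| "polyline [a, b] = linepath a b"
| "polyline (a # b # c # xs) = linepath a b +++ polyline (b # c # xs)"

definition positive_polygon :: "complex list \<Rightarrow> bool" where
  "positive_polygon vs \<longleftrightarrow>
     (let \<gamma> = polyline (vs @ [hd vs])
      in simple_path \<gamma> \<and> (\<forall>z\<in>inside (path_image \<gamma>). winding_number \<gamma> z = 1))"

text \<open>The vertices of all triangles are anticlockwise with respect to one side of the surface:
  neighbouring triangles traverse their common edge in opposite directions. In particular an edge
  belongs to at most two triangles. The boundary consists of the edges that belong to only one
  triangle. The numbering of the boundary segments need not follow the curve, but their directions
  do, whence the list \<open>vs\<close> of successive vertices.\<close>

definition polygonal_surface :: "mesh \<Rightarrow> bool" where
  "polygonal_surface M \<longleftrightarrow>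
     (\<forall>j\<in>{1..n_tri M}. \<not> collinear {tri M j 1, tri M j 2, tri M j 3}) \<and>
     (\<forall>i\<in>{1..n_tri M}. \<forall>j\<in>{1..n_tri M}. i \<noteq> j \<longrightarrow> open_tri M i \<inter> open_tri M j = {}) \<and>
     triangulation (closed_tri M ` {1..n_tri M}) \<and>
     (\<forall>i\<in>{1..n_tri M}. \<forall>j\<in>{1..n_tri M}. i \<noteq> j \<longrightarrow> tri_dir_edges M i \<inter> tri_dir_edges M j = {}) \<and>
     (\<lambda>j. {bseg M j 1, bseg M j 2}) ` {1..n_bseg M}
       = {e. \<exists>!j. j \<in> {1..n_tri M} \<and> e \<in> tri_edges M j} \<and>
     (\<forall>j\<in>{1..n_bseg M}. bseg M j 1 $ 3 = 0 \<and> bseg M j 2 $ 3 = 0) \<and>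
     (\<exists>vs. length vs = n_bseg M \<and>
        (\<lambda>j. (bseg M j 1, bseg M j 2)) ` {1..n_bseg M} = set (zip vs (rotate1 vs)) \<and>
        positive_polygon (map to_plane vs))"

text \<open>If \<open>F\<close> is affine on the closed triangles of \<open>M\<close>, the following mesh has the triangles
  \<open>F ` open_tri M j\<close>, the surface \<open>F ` surf M\<close> and the boundary curve \<open>F ` bcurve M\<close>.\<close>

definition image_mesh :: "(real^3 \<Rightarrow> real^3) \<Rightarrow> mesh \<Rightarrow> mesh" where
  "image_mesh F M =
     M\<lparr>tri := (\<lambda>j k. F (tri M j k)), bseg := (\<lambda>j k. F (bseg M j k))\<rparr>"

definition tri_area :: "mesh \<Rightarrow> nat \<Rightarrow> real" where
  "tri_area M j = norm (cross3 (tri M j 2 - tri M j 1) (tri M j 3 - tri M j 1)) / 2"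

definition surf_area :: "mesh \<Rightarrow> real" where
  "surf_area M = (\<Sum>j = 1..n_tri M. tri_area M j)"

definition enclosed_area :: "mesh \<Rightarrow> real" where
  "enclosed_area M = measure lebesgue (inside (to_plane ` bcurve M))"

section \<open>Normals and derivatives\<close>

text \<open>Functions on the surface or on its boundary curve are represented by functions on the whole
  space whose values elsewhere play no role. The piecewise defined ones below are meaningful on the
  open triangles and on the open segments, respectively.\<close>

definition tri_of :: "mesh \<Rightarrow> real^3 \<Rightarrow> nat" where
  "tri_of M x = (THE j. j \<in> {1..n_tri M} \<and> x \<in> open_tri M j)"

definition bseg_of :: "mesh \<Rightarrow> real^3 \<Rightarrow> nat" where
  "bseg_of M x = (THE j. j \<in> {1..n_bseg M} \<and> x \<in> open_segment (bseg M j 1) (bseg M j 2))"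

definition surf_normal :: "mesh \<Rightarrow> real^3 \<Rightarrow> real^3" where
  "surf_normal M x =
     (let j = tri_of M x; w = cross3 (tri M j 2 - tri M j 1) (tri M j 3 - tri M j 1)
      in w /\<^sub>R norm w)"

definition bdry_normal :: "mesh \<Rightarrow> real^3 \<Rightarrow> real^3" where
  "bdry_normal M x =
     (let j = bseg_of M x; w = cross3 (bseg M j 2 - bseg M j 1) e_z in w /\<^sub>R norm w)"

text \<open>As \<open>f\<close> is given on the triangle only, its gradient \<open>G\<close> is determined up to a multiple of the
  normal, which the projection removes.\<close>

definition surf_grad :: "mesh \<Rightarrow> (real^3 \<Rightarrow> real) \<Rightarrow> real^3 \<Rightarrow> real^3" where
  "surf_grad M f x =
     (THE v. \<exists>G. (f has_derivative (\<lambda>h. G \<bullet> h)) (at x within open_tri M (tri_of M x)) \<and>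
                 v = G - (surf_normal M x \<bullet> G) *\<^sub>R surf_normal M x)"

definition surf_grad_vec :: "mesh \<Rightarrow> (real^3 \<Rightarrow> real^3) \<Rightarrow> real^3 \<Rightarrow> real^3^3" where
  "surf_grad_vec M F x = (\<chi> i. surf_grad M (\<lambda>y. F y $ i) x)"

definition arc_deriv :: "mesh \<Rightarrow> (real^3 \<Rightarrow> real^3) \<Rightarrow> real^3 \<Rightarrow> real^3" where
  "arc_deriv M F x =
     (let j = bseg_of M x; d = bseg M j 2 - bseg M j 1
      in vector_derivative (\<lambda>s. F (x + s *\<^sub>R (d /\<^sub>R norm d))) (at 0))"

text \<open>The time-averaged normal for the step from \<open>M\<close> with the deformation \<open>X\<close>.\<close>

definition bdry_normal_half :: "mesh \<Rightarrow> (real^3 \<Rightarrow> real^3) \<Rightarrow> real^3 \<Rightarrow> real^3" where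
  "bdry_normal_half M X x =
     (1/2) *\<^sub>R cross3 (arc_deriv M (\<lambda>y. y) x + arc_deriv M X x) e_z"

section \<open>Inner products\<close>

text \<open>The area and arc length integrals are written in affine coordinates. The inner product on
  \<open>real^3^3\<close> is the Frobenius product.\<close>

definition surf_integral :: "mesh \<Rightarrow> (real^3 \<Rightarrow> real) \<Rightarrow> real" where
  "surf_integral M f =
     (\<Sum>j = 1..n_tri M. 2 * tri_area M j *
        (LINT w:{(u, v). 0 < u \<and> 0 < v \<and> u + v < 1}|lborel.
           f (tri M j 1 + fst w *\<^sub>R (tri M j 2 - tri M j 1) + snd w *\<^sub>R (tri M j 3 - tri M j 1))))"

definition bdry_integral :: "mesh \<Rightarrow> (real^3 \<Rightarrow> real) \<Rightarrow> real" where
  "bdry_integral M f =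
     (\<Sum>j = 1..n_bseg M. norm (bseg M j 2 - bseg M j 1) *
        (LINT t:{0<..<1}|lborel. f (bseg M j 1 + t *\<^sub>R (bseg M j 2 - bseg M j 1))))"

definition surf_inner :: "mesh \<Rightarrow> (real^3 \<Rightarrow> 'a::real_inner) \<Rightarrow> (real^3 \<Rightarrow> 'a) \<Rightarrow> real" where
  "surf_inner M f g = surf_integral M (\<lambda>x. f x \<bullet> g x)"

definition bdry_inner :: "mesh \<Rightarrow> (real^3 \<Rightarrow> 'a::real_inner) \<Rightarrow> (real^3 \<Rightarrow> 'a) \<Rightarrow> real" where
  "bdry_inner M f g = bdry_integral M (\<lambda>x. f x \<bullet> g x)"

definition surf_norm :: "mesh \<Rightarrow> (real^3 \<Rightarrow> 'a::real_inner) \<Rightarrow> real" where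
  "surf_norm M f = sqrt (surf_inner M f f)"

definition bdry_norm :: "mesh \<Rightarrow> (real^3 \<Rightarrow> 'a::real_inner) \<Rightarrow> real" where
  "bdry_norm M f = sqrt (bdry_inner M f f)"

definition lumped_inner :: "mesh \<Rightarrow> (real^3 \<Rightarrow> 'a::real_inner) \<Rightarrow> (real^3 \<Rightarrow> 'a) \<Rightarrow> real" where
  "lumped_inner M f g =
     (1/3) * (\<Sum>j = 1..n_tri M. \<Sum>k = 1..3. tri_area M j *
        (Lim (at (tri M j k) within open_tri M j) f \<bullet> Lim (at (tri M j k) within open_tri M j) g))"

section \<open>Finite element spaces and the scheme\<close>

definition fe_space :: "mesh \<Rightarrow> (real^3 \<Rightarrow> real) set" where
  "fe_space M =
     {f. continuous_on (surf M) f \<and>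
         (\<forall>j\<in>{1..n_tri M}. \<exists>a b. \<forall>x\<in>open_tri M j. f x = a \<bullet> x + b)}"

definition fe_space_0 :: "mesh \<Rightarrow> (real^3 \<Rightarrow> real) set" where
  "fe_space_0 M = {f \<in> fe_space M. \<forall>x\<in>bcurve M. f x = 0}"

definition fe_space_vec :: "mesh \<Rightarrow> (real^3 \<Rightarrow> real^3) set" where
  "fe_space_vec M =
     {F. (\<lambda>x. F x $ 1) \<in> fe_space M \<and> (\<lambda>x. F x $ 2) \<in> fe_space M \<and> (\<lambda>x. F x $ 3) \<in> fe_space_0 M}"

text \<open>One time step on the surface of \<open>M\<close>; the old parametrization is the identity.\<close>

definition scheme_step ::
    "real \<Rightarrow> real \<Rightarrow> real \<Rightarrow> mesh \<Rightarrow> (real^3 \<Rightarrow> real^3) \<Rightarrow> (real^3 \<Rightarrow> real) \<Rightarrow> bool" where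
  "scheme_step \<tau> \<eta> \<theta> M X H \<longleftrightarrow>
     X \<in> fe_space_vec M \<and> H \<in> fe_space M \<and>
     (\<forall>\<psi>\<in>fe_space M.
        lumped_inner M (\<lambda>x. (X x - x) /\<^sub>R \<tau>) (\<lambda>x. \<psi> x *\<^sub>R surf_normal M x)
        + surf_inner M (surf_grad M H) (surf_grad M \<psi>) = 0) \<and>
     (\<forall>g\<in>fe_space_vec M.
        lumped_inner M (\<lambda>x. H x *\<^sub>R surf_normal M x) g
        - surf_inner M (surf_grad_vec M X) (surf_grad_vec M g)
        + cos \<theta> * bdry_inner M (bdry_normal_half M X) g
        - 1 / (\<eta> * \<tau>) * bdry_inner M (\<lambda>x. (X x - x) \<bullet> bdry_normal M x) (\<lambda>x. g x \<bullet> bdry_normal M x)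
        = 0)"

end

theory Submission
  imports Defs
begin

text \<open>The scheme is tested with \<open>\<psi> = H\<close> and \<open>g = X - id\<close>. The first equation turns the common
  lumped product into the dissipation of \<open>H\<close>, so two facts about one time step remain.

  On a triangle with edges \<open>e1, e2\<close>, where \<open>X\<close> has linear part \<open>A\<close>, the Dirichlet energy of \<open>X\<close>
  bounds the area of the image triangle, with equality for the identity; by convexity of the energy
  the Dirichlet product of \<open>X\<close> and \<open>X - id\<close> bounds the increase of the surface area.

  The boundary term with the time-averaged normal is exactly the increase of the enclosed area: by
  bilinearity it is the difference of the two shoelace sums, up to terms that telescope around the
  curve. The shoelace formula for a simple polygon is obtained by integrating the winding number,
  which for almost every point is the sum of the winding numbers of the triangles spanned by the
  origin and the edges.\<close>

section \<open>The area enclosed by a polygon\<close>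

lemma path_polyline: "path (polyline zs)"
  and pathstart_polyline: "zs \<noteq> [] \<Longrightarrow> pathstart (polyline zs) = hd zs"
  and pathfinish_polyline: "zs \<noteq> [] \<Longrightarrow> pathfinish (polyline zs) = last zs"
  by (induction zs rule: polyline.induct) auto

lemma path_image_polyline:
  "2 \<le> length zs \<Longrightarrow>
    path_image (polyline zs) = (\<Union>(a, b)\<in>set (zip zs (tl zs)). closed_segment a b)"
  by (induction zs rule: polyline.induct)
    (auto simp: path_image_join pathstart_polyline)

lemma winding_number_polyline:
  "2 \<le> length zs \<Longrightarrow> z \<notin> path_image (polyline zs) \<Longrightarrow>
    winding_number (polyline zs) z = (\<Sum>(a, b)\<leftarrow>zip zs (tl zs). winding_number (linepath a b) z)"
  by (induction zs rule: polyline.induct)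
    (auto simp: path_image_join pathstart_polyline path_polyline winding_number_join)

lemma set_subset_path_image_polyline: "set zs \<subseteq> path_image (polyline zs)" if "zs \<noteq> []"
  using that
  by (induction zs rule: polyline.induct) (auto simp: path_image_join pathstart_polyline)

text \<open>The first segment of an arc meets the remaining polyline only at the joint
  \<open>b\<close>, and \<open>a\<close> differs from \<open>b\<close>; since all later vertices lie
  on that remainder, \<open>a\<close> is none of them.\<close>

lemma arc_polyline_distinct:
  "2 \<le> length zs \<Longrightarrow> arc (polyline zs) \<Longrightarrow> distinct zs"
proof (induction zs rule: polyline.induct)
  case (4 a b c xs)
  have *: "arc (linepath a b) \<and> arc (polyline (b # c # xs)) \<and>
      path_image (linepath a b) \<inter> path_image (polyline (b # c # xs)) \<subseteq> {b}"
    using 4(3) by (simp add: arc_join_eq pathstart_polyline)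
  then have "a \<noteq> b" using arc_distinct_ends[of "linepath a b"] by auto
  then have "a \<notin> path_image (polyline (b # c # xs))"
    using * by auto
  then have "a \<notin> set (b # c # xs)"
    using set_subset_path_image_polyline[of "b # c # xs"] by auto
  then show ?case using 4(1) * by auto
qed (auto dest: arc_distinct_ends)

lemma open_segment_disjoint_if_Int_subset:
  fixes a b c d :: "'a::euclidean_space"
  assumes "closed_segment a b \<inter> closed_segment c d \<subseteq> {a, b}"
  shows "open_segment a b \<inter> open_segment c d = {}"
  using assms by (auto simp: open_segment_def)

text \<open>By \<open>sorted_wrt\<close> the edges are compared by position in the list rather than
  as pairs of points, which matches the induction that splits off the first segment.\<close>

lemma arc_polyline_disjoint:
  "2 \<le> length zs \<Longrightarrow> arc (polyline zs) \<Longrightarrow>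
    sorted_wrt (\<lambda>(a, b) (c, d). open_segment a b \<inter> open_segment c d = {}) (zip zs (tl zs))"
proof (induction zs rule: polyline.induct)
  case (4 a b c xs)
  have *: "arc (polyline (b # c # xs))"
      "closed_segment a b \<inter> path_image (polyline (b # c # xs)) \<subseteq> {b}"
    using 4(3) by (simp_all add: arc_join_eq pathstart_polyline)
  have "open_segment a b \<inter> open_segment c' d' = {}"
    if "(c', d') \<in> set (zip (b # c # xs) (c # xs))" for c' d'
  proof (rule open_segment_disjoint_if_Int_subset)
    have "closed_segment c' d' \<subseteq> path_image (polyline (b # c # xs))"
      using that by (subst path_image_polyline) auto
    then show "closed_segment a b \<inter> closed_segment c' d' \<subseteq> {a, b}" using * by blast
  qed
  then show ?case using 4(1) * by auto
qed auto

text \<open>Bridges the two descriptions of the edges of a closed polygon: cyclic rotation in the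
  mesh, repetition of the first vertex in \<open>positive_polygon\<close>.\<close>

lemma zip_rotate1_eq: "vs \<noteq> [] \<Longrightarrow> zip vs (rotate1 vs) = zip (vs @ [hd vs]) (tl (vs @ [hd vs]))"
  by (subst zip_append1) (cases vs; simp)

text \<open>Removing the first edge from a simple closed polyline leaves an arc, which that edge
  meets in its two endpoints only; the lemmas on arcs then cover the remaining edges.\<close>

lemma positive_polygonD:
  assumes "positive_polygon vs"
  shows "2 \<le> length vs" "distinct vs"
    "sorted_wrt (\<lambda>(a, b) (c, d). open_segment a b \<inter> open_segment c d = {}) (zip vs (rotate1 vs))"
proof -
  have s: "simple_path (polyline (vs @ [hd vs]))"
    using assms by (simp add: positive_polygon_def Let_def)
  \<comment> \<open>Rules out lists of at most one vertex: closing them up gives a constant path,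
    whose values at the parameters 0 and 1/2 agree.\<close>
  have no: "\<not> simple_path (linepath c c)" for c :: complex
  proof
    assume "simple_path (linepath c c)"
    then have *: "\<forall>x\<in>{0..1}. \<forall>y\<in>{0..1}. linepath c c x = linepath c c y \<longrightarrow>
        x = y \<or> x = 0 \<and> y = 1 \<or> x = 1 \<and> y = 0"
      by (simp add: simple_path_def loop_free_def)
    show False using bspec[OF bspec[OF *, of 0], of "1/2"] by (simp add: linepath_refl)
  qed
  obtain a b xs where vs: "vs = a # b # xs"
    using s no by (cases vs rule: polyline.cases) auto
  then show "2 \<le> length vs" by simp
  let ?p = "polyline (b # xs @ [a])"
  \<comment> \<open>Exposes a third vertex, so that the last equation of \<open>polyline\<close>
    applies even if \<open>xs\<close> is empty.\<close>
  obtain y ys where y: "xs @ [a] = y # ys" by (cases xs) auto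
  have "simple_path (linepath a b +++ ?p)"
    using s unfolding vs by (simp add: y)
  then have *: "arc (linepath a b) \<and> arc ?p \<and> closed_segment a b \<inter> path_image ?p \<subseteq> {a, b}"
    by (subst (asm) simple_path_join_loop_eq) (auto simp: pathstart_polyline pathfinish_polyline)
  then show "distinct vs"
    using arc_polyline_distinct[of "b # xs @ [a]"] by (auto simp: vs)
  have "open_segment a b \<inter> open_segment c' d' = {}"
    if "(c', d') \<in> set (zip (b # xs) (xs @ [a]))" for c' d'
  proof (rule open_segment_disjoint_if_Int_subset)
    have "closed_segment c' d' \<subseteq> path_image ?p"
      using that by (subst path_image_polyline) (auto simp: zip_append1 simp flip: append_Cons)
    then show "closed_segment a b \<inter> closed_segment c' d' \<subseteq> {a, b}" using * by blast
  qed
  moreover have "sorted_wrt (\<lambda>(a, b) (c, d). open_segment a b \<inter> open_segment c d = {})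
     (zip (b # xs) (xs @ [a]))"
    using arc_polyline_disjoint[of "b # xs @ [a]"] *
    by (simp add: zip_append1 flip: append_Cons)
  ultimately show "sorted_wrt (\<lambda>(a, b) (c, d). open_segment a b \<inter> open_segment c d = {}) (zip vs (rotate1 vs))"
    by (auto simp: vs)
qed

text \<open>Serves twice: it cancels the spokes from the origin in the winding number, and the
  vertex terms in the boundary product.\<close>

lemma sum_list_zip_rotate1_telescope:
  fixes f :: "'a \<Rightarrow> 'b::ab_group_add"
  shows "(\<Sum>(a, b)\<leftarrow>zip vs (rotate1 vs). f b - f a) = 0"
proof (cases vs)
  case (Cons a xs)
  have "(\<Sum>(a, b)\<leftarrow>zip (c # xs) (xs @ [a]). f b - f a) = f a - f c" for c
    by (induction xs arbitrary: c) auto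
  from this[of a] show ?thesis by (simp add: Cons)
qed simp

section \<open>Areas of triangles in the complex plane\<close>

text \<open>Winding numbers live on \<open>complex\<close>, but the area formula
  \<open>content_triangle\<close> on \<open>real^2\<close>; this transports the measure. Lebesgue
  measure is determined by its values on boxes, and boxes correspond to boxes.\<close>

lemma lborel_complex_eq_distr:
  "(lborel :: complex measure) = distr lborel borel (\<lambda>v::real^2. Complex (v $ 1) (v $ 2))"
proof (rule lborel_eqI)
  have c: "continuous_on UNIV (\<lambda>v::real^2. Complex (v $ 1) (v $ 2))"
    by (simp add: Complex_eq continuous_on_component continuous_on_add continuous_on_mult continuous_on_of_real) 
  then have m: "(\<lambda>v::real^2. Complex (v $ 1) (v $ 2)) \<in> borel_measurable lborel"
    by (simp add: borel_measurable_continuous_onI)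
  fix l u :: complex
  assume lu: "\<And>b. b \<in> Basis \<Longrightarrow> l \<bullet> b \<le> u \<bullet> b"
  have B: "Basis = {axis 1 1, axis 2 1 :: real^2}"
    by (auto simp: Basis_vec_def UNIV_2)
  have le: "\<forall>i. vector [Re l, Im l] $ i \<le> (vector [Re u, Im u] :: real^2) $ i"
    using lu[of 1] lu[of \<i>] by (simp add: forall_2 Basis_complex_def inner_complex_def)
  have pre: "(\<lambda>v::real^2. Complex (v $ 1) (v $ 2)) -` box l u
      = box (vector [Re l, Im l]) (vector [Re u, Im u])"
    by (auto simp: box_def Basis_complex_def forall_2 inner_axis Basis_vec_def inner_complex_def)
  have "emeasure lborel (box (vector [Re l, Im l]) (vector [Re u, Im u]) :: (real^2) set)
      = (\<Prod>b\<in>Basis. (vector [Re u, Im u] - vector [Re l, Im l] :: real^2) \<bullet> b)"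
    using le by (intro emeasure_lborel_box) (auto simp: Basis_vec_def inner_axis)
  also have "(\<Prod>b\<in>Basis. (vector [Re u, Im u] - vector [Re l, Im l] :: real^2) \<bullet> b)
      = (\<Prod>b\<in>Basis. (u - l) \<bullet> b)"
    unfolding B by (simp add: Basis_complex_def inner_complex_def inner_axis axis_eq_axis)
  finally show "emeasure (distr lborel borel (\<lambda>v::real^2. Complex (v $ 1) (v $ 2))) (box l u)
      = (\<Prod>b\<in>Basis. (u - l) \<bullet> b)"
    using m by (simp add: emeasure_distr pre)
qed simp

text \<open>\<open>Im (cnj a * b)\<close> is the plane cross product of \<open>a\<close> and
  \<open>b\<close>. The interior has the measure of the whole triangle because the frontier of a
  convex set is negligible; degenerate triangles are included.\<close>

lemma measure_triangle_0:
  "measure lebesgue (interior (convex hull {0, a, b})) = \<bar>Im (cnj a * b)\<bar> / 2" for a b :: complex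
proof -
  let ?h = "\<lambda>v::real^2. Complex (v $ 1) (v $ 2)" and ?S = "convex hull {0, a, b}"
  let ?g = "\<lambda>z. vector [Re z, Im z] :: real^2"
  have lin: "linear ?g"
    by (auto simp: linear_iff vec_eq_iff forall_2)
  have c: "compact ?S" by (simp add: finite_imp_compact_convex_hull)
  have h: "?h (?g z) = z" "?g (?h v) = v" for z v by (auto simp: vec_eq_iff forall_2)
  then have "?h -` ?S = ?g ` ?S"
        by (auto simp: image_iff) (metis h)
  also have "\<dots> = convex hull {0, ?g a, ?g b}"
    using convex_hull_linear_image[OF lin, of "{0, a, b}"] linear_0[OF lin] by simp
  finally have pre: "?h -` ?S = convex hull {0, ?g a, ?g b}" .
  have cont: "continuous_on UNIV ?h"
    by (simp add: Complex_eq continuous_on_component continuous_on_add continuous_on_mult continuous_on_of_real)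
  then have m: "?h \<in> borel_measurable lborel"
    by (simp add: borel_measurable_continuous_onI)
  have "measure lebesgue (interior ?S) = measure lebesgue ?S"
    using c by (intro measure_interior negligible_convex_frontier) (simp_all add: compact_imp_bounded)
  also have "\<dots> = measure lborel ?S"
    using c by (intro measure_completion) (simp add: borel_compact)
  also have "\<dots> = measure (distr lborel borel ?h) ?S"
    by (rule arg_cong[OF lborel_complex_eq_distr, of "\<lambda>M. measure M ?S"])
  also have "\<dots> = measure lborel (?h -` ?S)"
    using measure_distr[OF m borel_compact[OF c]] by simp
  also have "\<dots> = \<bar>Im (cnj a * b)\<bar> / 2"
    unfolding pre content_triangle by (simp add: abs_minus_commute mult.commute)
  finally show ?thesis .
qed

section \<open>Winding numbers and the shoelace formula\<close>

text \<open>The boundary of a triangle winds around interior points once, with the sign of its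
  orientation, and not at all around exterior points. The third side is written as a reversed spoke
  with a minus sign, ready for cancellation around a polygon.\<close>

lemma winding_number_triangle_0:
  assumes "z \<notin> closed_segment 0 a" "z \<notin> closed_segment a b" "z \<notin> closed_segment b 0"
    and "z \<notin> frontier (convex hull {0, a, b})"
  shows "winding_number (linepath 0 a) z + winding_number (linepath a b) z
      - winding_number (linepath 0 b) z
    = of_real (sgn (Im (cnj a * b)) * indicator (interior (convex hull {0, a, b})) z)"
proof -
  let ?T = "linepath 0 a +++ linepath a b +++ linepath b 0"
  have "winding_number (linepath b 0) z = - winding_number (linepath 0 b) z"
    using assms(3) winding_number_reversepath[of "linepath 0 b" z]
    by (simp add: closed_segment_commute)
  then have "winding_number ?T z = winding_number (linepath 0 a) z + winding_number (linepath a b) z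
      - winding_number (linepath 0 b) z"
    using assms(1-3) by (simp add: winding_number_join path_image_join)
  moreover have "winding_number ?T z = of_real (sgn (Im (cnj a * b)) * indicator (interior (convex hull {0, a, b})) z)"
  proof (cases "z \<in> interior (convex hull {0, a, b})")
    case True
    \<comment> \<open>An interior point forces positive area: a nonempty open set is not
      negligible.\<close>
    have nz: "Im (cnj a * b) \<noteq> 0"
    proof
      assume "Im (cnj a * b) = 0"
      then have "measure lebesgue (interior (convex hull {0, a, b})) = 0"
        by (simp add: measure_triangle_0)
      moreover have "interior (convex hull {0, a, b}) \<in> lmeasurable"
        by (intro lmeasurable_interior) (simp add: finite_imp_bounded_convex_hull)
      ultimately have "negligible (interior (convex hull {0, a, b}))"
        by (simp add: negligible_iff_measure)
      then show False using True open_not_negligible by (metis open_interior empty_iff)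
    qed
    obtain w v where wv: "0 \<le> w" "0 \<le> v" "v + w \<le> 1" "z = v *\<^sub>R a + w *\<^sub>R b"
      using subsetD[OF interior_subset True] by (auto simp: convex_hull_3)
    have "w \<noteq> 0"
    proof
      assume "w = 0"
      then have "z \<in> closed_segment 0 a" using wv by (auto simp: in_segment intro!: exI[of _ v])
      then show False using assms(1) by simp
    qed
    \<comment> \<open>The left side decides the sign in \<open>winding_number_triangle\<close>; in
      barycentric coordinates it is a positive multiple of the orientation of the triangle, as
      \<open>w\<close> vanishes only on the side from 0 to \<open>a\<close>.\<close>
    have "Im ((a - 0) * cnj (a - z)) = w * Im (cnj a * b)"
      unfolding wv(4) by (simp add: algebra_simps)
    then have "0 < Im ((a - 0) * cnj (a - z)) \<longleftrightarrow> 0 < Im (cnj a * b)"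
      using wv(1) \<open>w \<noteq> 0\<close> by (simp only: zero_less_mult_iff) linarith
    then have "winding_number ?T z = (if 0 < Im (cnj a * b) then 1 else - 1)"
      using winding_number_triangle[OF True] by (simp only: )
    also have "\<dots> = of_real (sgn (Im (cnj a * b)))"
      using nz by (simp only: sgn_if if_False if_True split: if_split) simp
    finally show ?thesis using True by (simp only: indicator_simps mult_1_right)
  next
    case False
    have c: "closed (convex hull {0, a, b})"
      by (simp add: finite_imp_compact_convex_hull compact_imp_closed)
    have "z \<notin> convex hull {0, a, b}"
      using assms(4) False c by (auto simp: frontier_def closure_closed)
    moreover have "path_image ?T \<subseteq> convex hull {0, a, b}"
      by (simp add: path_image_join segment_convex_hull hull_mono)
    ultimately have "winding_number ?T z = 0"
      by (intro winding_number_zero_outside[of _ "convex hull {0, a, b}"]) auto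
    then show ?thesis using False by simp
  qed
  ultimately show ?thesis by simp
qed

lemma negligible_closed_segment_complex: "negligible (closed_segment a (b :: complex))"
  by (simp add: negligible_convex_interior interior_closed_segment_ge2)

lemma has_integral_sum_list:
  assumes "\<And>x. x \<in> set xs \<Longrightarrow> (f x has_integral i x) S"
  shows "((\<lambda>z. \<Sum>x\<leftarrow>xs. f x z) has_integral (\<Sum>x\<leftarrow>xs. i x)) S"
  using assms by (induction xs) (auto intro!: has_integral_add)

theorem measure_inside_positive_polygon:
  assumes "positive_polygon vs"
  shows "measure lebesgue (inside (path_image (polyline (vs @ [hd vs]))))
    = (\<Sum>(a, b)\<leftarrow>zip vs (rotate1 vs). Im (cnj a * b)) / 2"
proof -
  define \<gamma> where "\<gamma> = polyline (vs @ [hd vs])"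
  define E where "E = zip vs (rotate1 vs)"
  have len: "2 \<le> length (vs @ [hd vs])" "vs \<noteq> []"
    using positive_polygonD(1)[OF assms] by auto
  have E: "E = zip (vs @ [hd vs]) (tl (vs @ [hd vs]))"
    using len by (simp add: E_def zip_rotate1_eq)
  have \<gamma>: "path \<gamma>" "pathfinish \<gamma> = pathstart \<gamma>"
    using len by (auto simp: \<gamma>_def path_polyline pathstart_polyline pathfinish_polyline)
  have im: "path_image \<gamma> = (\<Union>(a, b)\<in>set E. closed_segment a b)"
    unfolding \<gamma>_def E using path_image_polyline[OF len(1)] .
  have comp: "compact (path_image \<gamma>)" using \<gamma> by (simp add: compact_path_image)
  have pos: "\<And>z. z \<in> inside (path_image \<gamma>) \<Longrightarrow> winding_number \<gamma> z = 1"
    using assms by (simp add: positive_polygon_def Let_def \<gamma>_def)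
  \<comment> \<open>The exceptional set: off \<open>N\<close> all winding numbers involved are
    meaningful, and every point is either inside or outside each triangle.\<close>
  define N where "N = (\<Union>(a, b)\<in>set E. closed_segment 0 a \<union> closed_segment a b \<union> closed_segment b 0
      \<union> frontier (convex hull {0, a, b}))"
  have N: "negligible N"
    unfolding N_def
    by (intro negligible_Union) (auto intro!: negligible_closed_segment_complex negligible_convex_frontier)
  have wn: "indicator (inside (path_image \<gamma>)) z
      = (\<Sum>(a, b)\<leftarrow>E. sgn (Im (cnj a * b)) * indicator (interior (convex hull {0, a, b})) z)"
    if z: "z \<notin> N" for z
  proof -
    have nz: "z \<notin> path_image \<gamma>" using z unfolding im N_def by blast
    \<comment> \<open>Positive orientation gives winding number 1 inside; outside it is 0.\<close>
    have "of_real (indicator (inside (path_image \<gamma>)) z) = winding_number \<gamma> z"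
    proof (cases "z \<in> inside (path_image \<gamma>)")
      case False
      then have "z \<in> outside (path_image \<gamma>)"
        using nz by (metis ComplI UnE inside_Un_outside)
      then show ?thesis using False \<gamma> by (simp add: winding_number_zero_in_outside)
    qed (simp add: pos)
    also have "\<dots> = (\<Sum>(a, b)\<leftarrow>E. winding_number (linepath a b) z)"
      unfolding E \<gamma>_def using nz len by (intro winding_number_polyline) (auto simp: \<gamma>_def)
    \<comment> \<open>The subtracted sum telescopes to 0; it supplies each edge with the two spokes
      that close it to a triangle with apex 0.\<close>
    also have "\<dots> = (\<Sum>(a, b)\<leftarrow>E. winding_number (linepath a b) z)
        - (\<Sum>(a, b)\<leftarrow>E. winding_number (linepath 0 b) z - winding_number (linepath 0 a) z)"
      unfolding E_def sum_list_zip_rotate1_telescope by simp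
    also have "\<dots> = (\<Sum>(a, b)\<leftarrow>E. winding_number (linepath 0 a) z + winding_number (linepath a b) z
      - winding_number (linepath 0 b) z)"
      by (subst sum_list_subtractf[symmetric]) (simp add: case_prod_unfold algebra_simps)
    also have "\<dots> = (\<Sum>(a, b)\<leftarrow>E. of_real (sgn (Im (cnj a * b)) * indicator (interior (convex hull {0, a, b})) z))"
    proof (intro arg_cong[where f = sum_list] map_cong refl, clarify)
      fix a b assume ab: "(a, b) \<in> set E"
      show "winding_number (linepath 0 a) z + winding_number (linepath a b) z
          - winding_number (linepath 0 b) z
        = of_real (sgn (Im (cnj a * b)) * indicator (interior (convex hull {0, a, b})) z)"
        using z ab unfolding N_def by (intro winding_number_triangle_0) blast+
    qed
    also have "\<dots> = of_real (\<Sum>(a, b)\<leftarrow>E. sgn (Im (cnj a * b)) * indicator (interior (convex hull {0, a, b})) z)"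
      by (induction E) auto
    finally show ?thesis using of_real_eq_iff by blast
  qed
  have "((\<lambda>z. \<Sum>(a, b)\<leftarrow>E. sgn (Im (cnj a * b)) * indicator (interior (convex hull {0, a, b})) z)
      has_integral (\<Sum>(a, b)\<leftarrow>E. Im (cnj a * b) / 2)) UNIV"
    unfolding case_prod_unfold
  proof (rule has_integral_sum_list)
    fix e :: "complex \<times> complex"
    let ?I = "interior (convex hull {0, fst e, snd e})" and ?d = "Im (cnj (fst e) * snd e)"
    have "?I \<in> lmeasurable"
      by (intro lmeasurable_interior) (simp add: finite_imp_bounded_convex_hull)
    then have "((indicator ?I) has_integral (\<bar>?d\<bar> / 2)) UNIV"
      by (metis lmeasurable_iff_has_integral measure_triangle_0)
    then have "((\<lambda>z. sgn ?d * indicator ?I z) has_integral (sgn ?d * (\<bar>?d\<bar> / 2))) UNIV"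
      by (rule has_integral_mult_right)
    \<comment> \<open>The orientation sign turns the unsigned area into the signed one, which is why
      the final sum has no absolute values.\<close>
    moreover have "sgn ?d * (\<bar>?d\<bar> / 2) = ?d / 2"
      by (simp add: mult_sgn_abs)
    ultimately show "((\<lambda>z. sgn ?d * indicator ?I z) has_integral ?d / 2) UNIV" by simp
  qed
  then have "((indicator (inside (path_image \<gamma>)) :: complex \<Rightarrow> real) has_integral (\<Sum>(a, b)\<leftarrow>E. Im (cnj a * b) / 2)) UNIV"
    by (rule has_integral_spike[OF N, rotated]) (use wn in auto)
  then have "measure lebesgue (inside (path_image \<gamma>)) = (\<Sum>(a, b)\<leftarrow>E. Im (cnj a * b) / 2)"
    by (metis lmeasurable_iff_indicator_has_integral)
  also have "\<dots> = (\<Sum>(a, b)\<leftarrow>E. Im (cnj a * b)) / 2"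
    by (induction E) (auto simp: add_divide_distrib)
  finally show ?thesis by (simp add: \<gamma>_def E_def)
qed

section \<open>Area and Dirichlet energy on a triangle\<close>

text \<open>Relative interior points of a simplex are those with positive barycentric coordinates;
  eliminating the coordinate of \<open>a\<close> gives the domain used in
  \<open>surf_integral\<close>.\<close>

lemma rel_interior_triangle:
  fixes a b c :: "'a::euclidean_space"
  assumes "\<not> collinear {a, b, c}"
  shows "rel_interior (convex hull {a, b, c})
    = (\<lambda>(u, v). a + u *\<^sub>R (b - a) + v *\<^sub>R (c - a)) ` {(u, v). 0 < u \<and> 0 < v \<and> u + v < 1}"
    (is "?L = ?R")
proof -
  have ne: "a \<noteq> b" "a \<noteq> c" "b \<noteq> c" and aff: "\<not> affine_dependent {a, b, c}"
    using assms by (auto simp: collinear_3_eq_affine_dependent)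
  have L: "?L = {y. \<exists>u. (\<forall>x\<in>{a, b, c}. 0 < u x) \<and> sum u {a, b, c} = 1 \<and> (\<Sum>x\<in>{a, b, c}. u x *\<^sub>R x) = y}"
    by (rule rel_interior_convex_hull_explicit[OF aff])
  show ?thesis
  proof (intro set_eqI iffI)
    fix y assume "y \<in> ?L"
    then obtain u where u: "0 < u a" "0 < u b" "0 < u c" "u a + u b + u c = 1"
        "y = u a *\<^sub>R a + u b *\<^sub>R b + u c *\<^sub>R c"
      unfolding L using ne by (auto simp: add.assoc)
    have ua: "u a = 1 - u b - u c" using u(4) by simp
    have "y = a + u b *\<^sub>R (b - a) + u c *\<^sub>R (c - a)"
      unfolding u(5) ua by (simp add: algebra_simps)
    then show "y \<in> ?R" using u by (intro image_eqI[of _ _ "(u b, u c)"]) auto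
  next
    fix y assume "y \<in> ?R"
    then obtain u v where uv: "0 < u" "0 < v" "u + v < 1" "y = a + u *\<^sub>R (b - a) + v *\<^sub>R (c - a)"
      by auto
    show "y \<in> ?L" unfolding L
      by (rule CollectI, rule exI[of _ "\<lambda>x. if x = a then 1 - u - v else if x = b then u else v"])
        (use uv ne in \<open>auto simp: algebra_simps\<close>)
  qed
qed

text \<open>The set is the interior of the standard simplex in the plane, of volume 1/2!.\<close>

lemma measure_std_triangle:
  "{(u, v). 0 < u \<and> 0 < v \<and> u + v < 1} \<in> sets (lborel :: (real \<times> real) measure)"
  "emeasure lborel {(u, v). 0 < u \<and> 0 < v \<and> u + v < (1 :: real)} \<noteq> (\<infinity>::ennreal)"
  "measure lborel {(u, v). 0 < u \<and> 0 < v \<and> u + v < (1 :: real)} = 1 / 2"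
proof -
  let ?T = "{(u, v). 0 < u \<and> 0 < v \<and> u + v < 1} :: (real \<times> real) set"
  let ?H = "convex hull (insert 0 Basis) :: (real \<times> real) set"
  have T: "?T = interior ?H"
    unfolding interior_std_simplex by (auto simp: Basis_prod_def)
  show s: "?T \<in> sets (lborel :: (real \<times> real) measure)" unfolding T by simp
  have b: "bounded ?H" by (simp add: finite_imp_bounded_convex_hull)
  have "measure lborel ?T = measure lebesgue ?T"
    using s by (simp add: measure_completion)
  also have "\<dots> = measure lebesgue ?H"
    unfolding T by (intro measure_interior b negligible_convex_frontier) simp
  also have "\<dots> = measure lborel ?H"
    by (intro measure_completion) (simp add: borel_compact finite_imp_compact_convex_hull)
  finally show "measure lborel ?T = 1 / 2"
    by (simp add: content_std_simplex)
  show "emeasure lborel ?T \<noteq> (\<infinity>::ennreal)"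
    using emeasure_bounded_finite[OF bounded_subset[OF b interior_subset]] unfolding T by simp
qed

text \<open>The reference triangle has area 1/2, cancelling the Jacobian factor 2. Gradients of
  finite element functions are constant on each open triangle, so their products are integrated this
  way.\<close>

lemma surf_integral_piecewise_const:
  assumes "polygonal_surface M"
    and "\<And>j x. j \<in> {1..n_tri M} \<Longrightarrow> x \<in> open_tri M j \<Longrightarrow> f x = c j"
  shows "surf_integral M f = (\<Sum>j = 1..n_tri M. tri_area M j * c j)"
  unfolding surf_integral_def
proof (rule sum.cong[OF refl])
  fix j assume j: "j \<in> {1..n_tri M}"
  let ?T = "{(u, v). 0 < u \<and> 0 < v \<and> u + v < 1} :: (real \<times> real) set"
  let ?p = "\<lambda>w. tri M j 1 + fst w *\<^sub>R (tri M j 2 - tri M j 1) + snd w *\<^sub>R (tri M j 3 - tri M j 1)"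
  have "\<not> collinear {tri M j 1, tri M j 2, tri M j 3}"
    using assms(1) j by (simp add: polygonal_surface_def)
  then have "f (?p w) = c j" if "w \<in> ?T" for w
    using that by (intro assms(2)[OF j])
      (auto simp: open_tri_def closed_tri_def rel_interior_triangle intro!: image_eqI[of _ _ w])
  then have "(LINT w:?T|lborel. f (?p w)) = (LINT w:?T|lborel. c j)"
    by (intro set_lebesgue_integral_cong measure_std_triangle) blast
  also have "\<dots> = c j / 2"
    by (subst set_integral_const[OF measure_std_triangle(1,2)]) (simp add: measure_std_triangle(3))
  finally show "2 * tri_area M j * (LINT w:?T|lborel. f (?p w)) = tri_area M j * c j"
    by simp
qed

section \<open>Surface gradients of affine functions\<close>

lemma tri_of_eq:
  assumes "polygonal_surface M" "j \<in> {1..n_tri M}" "x \<in> open_tri M j"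
  shows "tri_of M x = j"
  unfolding tri_of_def
proof (rule the_equality)
  fix i assume i: "i \<in> {1..n_tri M} \<and> x \<in> open_tri M i"
  have "\<forall>i\<in>{1..n_tri M}. \<forall>j\<in>{1..n_tri M}. i \<noteq> j \<longrightarrow> open_tri M i \<inter> open_tri M j = {}"
    using assms(1) by (simp add: polygonal_surface_def)
  with i assms(2,3) show "i = j" by blast
qed (use assms in blast)

lemma cross_eq_0_iff_collinear:
  "cross3 (b - a) (c - a) = 0 \<longleftrightarrow> collinear {a, b, c}"
  using collinear_3[of b a c] by (simp add: cross_eq_0 insert_commute)

text \<open>A vector orthogonal to both edges is parallel to the normal: its cross product with
  \<open>w\<close> vanishes, and one more cross product with \<open>w\<close> recovers
  \<open>D\<close> as a multiple of \<open>w\<close>.\<close>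

lemma proj_eq_0:
  fixes D e1 e2 :: "real^3"
  assumes "D \<bullet> e1 = 0" "D \<bullet> e2 = 0" "cross3 e1 e2 \<noteq> 0"
  defines "n \<equiv> cross3 e1 e2 /\<^sub>R norm (cross3 e1 e2)"
  shows "D = (n \<bullet> D) *\<^sub>R n"
proof -
  define w where "w = cross3 e1 e2"
  have "cross3 D w = 0"
    using assms(1,2) by (simp add: w_def Lagrange)
  then have "0 = cross3 w (cross3 D w)" by simp
  also have "\<dots> = (w \<bullet> w) *\<^sub>R D - (w \<bullet> D) *\<^sub>R w" by (rule Lagrange)
  finally have "(w \<bullet> w) *\<^sub>R D = (w \<bullet> D) *\<^sub>R w" by simp
  then have "inverse (w \<bullet> w) *\<^sub>R ((w \<bullet> w) *\<^sub>R D) = inverse (w \<bullet> w) *\<^sub>R ((w \<bullet> D) *\<^sub>R w)"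
    by (rule arg_cong)
  then have "D = ((w \<bullet> D) / (w \<bullet> w)) *\<^sub>R w"
    using assms(3) by (simp add: w_def divide_inverse mult.commute)
  also have "\<dots> = (n \<bullet> D) *\<^sub>R n"
    by (simp add: n_def flip: w_def) (simp add: field_simps dot_square_norm power2_eq_square)
  finally show ?thesis .
qed

text \<open>The vector \<open>a\<close> itself is a gradient. Any other gradient agrees with it
  along both edges, hence differs from it by a normal vector, which the projection removes.\<close>

lemma surf_grad_affine:
  assumes M: "polygonal_surface M" and j: "j \<in> {1..n_tri M}" and x: "x \<in> open_tri M j"
    and f: "\<And>y. y \<in> open_tri M j \<Longrightarrow> f y = a \<bullet> y + b"
  shows "surf_grad M f x = a - (surf_normal M x \<bullet> a) *\<^sub>R surf_normal M x"
proof -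
  let ?O = "open_tri M j" and ?n = "surf_normal M x"
  let ?q = "tri M j 1" and ?e1 = "tri M j 2 - tri M j 1" and ?e2 = "tri M j 3 - tri M j 1"
  have nc: "\<not> collinear {tri M j 1, tri M j 2, tri M j 3}"
    using M j by (simp add: polygonal_surface_def)
  then have w: "cross3 ?e1 ?e2 \<noteq> 0" by (simp add: cross_eq_0_iff_collinear)
  have n: "?n = cross3 ?e1 ?e2 /\<^sub>R norm (cross3 ?e1 ?e2)"
    by (simp add: surf_normal_def tri_of_eq[OF M j x] Let_def)
  have O: "?O = (\<lambda>(u, v). ?q + u *\<^sub>R ?e1 + v *\<^sub>R ?e2) ` {(u, v). 0 < u \<and> 0 < v \<and> u + v < 1}"
    using rel_interior_triangle[OF nc] by (simp add: open_tri_def closed_tri_def)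
  then obtain u v where uv: "0 < u" "0 < v" "u + v < 1" "x = ?q + u *\<^sub>R ?e1 + v *\<^sub>R ?e2"
    using x by auto
  \<comment> \<open>A derivative within the flat triangle is not unique in space. Restricted to a
    line that stays in the triangle near \<open>x\<close>, it becomes an ordinary derivative in one
    variable, which is unique.\<close>
  have dir: "G \<bullet> d = a \<bullet> d"
    if G: "(f has_derivative (\<lambda>h. G \<bullet> h)) (at x within ?O)"
      and T: "open T" "(0::real) \<in> T" "\<And>t. t \<in> T \<Longrightarrow> x + t *\<^sub>R d \<in> ?O" for G d T
  proof -
    have "((\<lambda>t. x + t *\<^sub>R d) has_derivative (\<lambda>t. t *\<^sub>R d)) (at 0 within T)"
      by (auto intro!: derivative_eq_intros)
    moreover have "(f has_derivative (\<lambda>h. G \<bullet> h)) (at (x + 0 *\<^sub>R d) within (\<lambda>t. x + t *\<^sub>R d) ` T)"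
      using T(3) by (auto intro!: has_derivative_subset[OF G])
    ultimately have "((\<lambda>t. f (x + t *\<^sub>R d)) has_derivative (\<lambda>t. G \<bullet> (t *\<^sub>R d))) (at 0 within T)"
      by (rule has_derivative_in_compose)
    then have "((\<lambda>t. f (x + t *\<^sub>R d)) has_derivative (\<lambda>t. G \<bullet> (t *\<^sub>R d))) (at 0)"
      by (simp only: at_within_open[OF T(2,1)])
    moreover have "((\<lambda>t. f (x + t *\<^sub>R d)) has_derivative (\<lambda>t. a \<bullet> (t *\<^sub>R d))) (at 0)"
    proof (rule has_derivative_transform_within_open[OF _ T(1,2)])
      show "((\<lambda>t. a \<bullet> (x + t *\<^sub>R d) + b) has_derivative (\<lambda>t. a \<bullet> (t *\<^sub>R d))) (at 0)"
        by (auto intro!: derivative_eq_intros)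
      show "\<And>t. t \<in> T \<Longrightarrow> a \<bullet> (x + t *\<^sub>R d) + b = f (x + t *\<^sub>R d)"
        using f T(3) by simp
    qed
    ultimately have "(\<lambda>t. G \<bullet> (t *\<^sub>R d)) = (\<lambda>t. a \<bullet> (t *\<^sub>R d))"
      by (rule has_derivative_unique)
    from fun_cong[OF this, of 1] show ?thesis by simp
  qed
  show ?thesis
    unfolding surf_grad_def tri_of_eq[OF M j x]
  proof (rule the_equality)
    have "(f has_derivative (\<lambda>h. a \<bullet> h)) (at x within ?O)"
      by (rule has_derivative_transform[OF x, of _ "\<lambda>y. a \<bullet> y + b"])
        (auto simp: f intro!: derivative_eq_intros)
    then show "\<exists>G. (f has_derivative (\<lambda>h. G \<bullet> h)) (at x within ?O) \<and>
        a - (?n \<bullet> a) *\<^sub>R ?n = G - (?n \<bullet> G) *\<^sub>R ?n" by blast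
  next
    fix z assume "\<exists>G. (f has_derivative (\<lambda>h. G \<bullet> h)) (at x within ?O) \<and> z = G - (?n \<bullet> G) *\<^sub>R ?n"
    then obtain G where G: "(f has_derivative (\<lambda>h. G \<bullet> h)) (at x within ?O)"
      and z: "z = G - (?n \<bullet> G) *\<^sub>R ?n" by blast
    \<comment> \<open>The bounds keep the shifted coordinate \<open>u + t\<close> positive and its
      sum with \<open>v\<close> below 1.\<close>
    have "x + t *\<^sub>R ?e1 \<in> ?O" if "t \<in> {- u<..<1 - u - v}" for t
      unfolding O using that uv by (intro image_eqI[of _ _ "(u + t, v)"]) (auto simp: algebra_simps)
    then have 1: "G \<bullet> ?e1 = a \<bullet> ?e1"
      using uv by (intro dir[OF G, of "{- u<..<1 - u - v}"]) auto
    have "x + t *\<^sub>R ?e2 \<in> ?O" if "t \<in> {- v<..<1 - u - v}" for t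
      unfolding O using that uv by (intro image_eqI[of _ _ "(u, v + t)"]) (auto simp: algebra_simps)
    then have 2: "G \<bullet> ?e2 = a \<bullet> ?e2"
      using uv by (intro dir[OF G, of "{- v<..<1 - u - v}"]) auto
    have "G - a = (?n \<bullet> (G - a)) *\<^sub>R ?n"
      unfolding n using 1 2 w by (intro proj_eq_0) (simp_all add: inner_diff_left)
    then show "z = a - (?n \<bullet> a) *\<^sub>R ?n"
      unfolding z by (simp add: inner_diff_right scaleR_diff_left algebra_simps)
  qed
qed

text \<open>Both squared norms complete the inner products to the same total (Lagrange), so the
  Cauchy--Schwarz inequality in the plane and AM-GM apply.\<close>

lemma norm_cross_le_mixed:
  fixes e1 e2 f1 f2 :: "real^3"
  shows "2 * (norm (cross3 e1 e2) * norm (cross3 f1 f2))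
    \<le> (norm e1 * norm f2)\<^sup>2 + (norm e2 * norm f1)\<^sup>2 - 2 * (e1 \<bullet> e2) * (f1 \<bullet> f2)"
proof -
  let ?w = "norm (cross3 e1 e2)" and ?g = "norm (cross3 f1 f2)" and ?c = "e1 \<bullet> e2" and ?d = "f1 \<bullet> f2"
  let ?p = "norm e1 * norm f2" and ?q = "norm e2 * norm f1"
  have "(?w * ?g + ?c * ?d)\<^sup>2 + (?w * ?d - ?c * ?g)\<^sup>2 = (?w\<^sup>2 + ?c\<^sup>2) * (?g\<^sup>2 + ?d\<^sup>2)"
    by (simp add: power2_eq_square algebra_simps)
  also have "\<dots> = (?p * ?q)\<^sup>2"
    unfolding norm_cross_dot by (simp add: power_mult_distrib algebra_simps)
  finally have "(?w * ?g + ?c * ?d)\<^sup>2 \<le> (?p * ?q)\<^sup>2"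
    using zero_le_power2[of "?w * ?d - ?c * ?g"] by linarith
  then have "?w * ?g + ?c * ?d \<le> ?p * ?q"
    by (rule power2_le_imp_le) simp
  moreover have "2 * (?p * ?q) \<le> ?p\<^sup>2 + ?q\<^sup>2"
    using sum_squares_bound[of ?p ?q] by (simp add: mult.assoc)
  ultimately show ?thesis by (simp add: algebra_simps)
qed

text \<open>Multiplied by the squared length of the normal \<open>?w\<close>, the squared norm of a
  projected row becomes a quadratic form in its products with \<open>e1\<close> and
  \<open>e2\<close>. Summed over the rows, these forms give the right side of
  \<open>norm_cross_le_mixed\<close> for the image edges.\<close>

lemma norm_cross_image_le:
  fixes A :: "real^3^3" and e1 e2 :: "real^3"
  assumes w: "cross3 e1 e2 \<noteq> 0"
  defines "n \<equiv> cross3 e1 e2 /\<^sub>R norm (cross3 e1 e2)"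
  shows "2 * norm (cross3 (A *v e1) (A *v e2))
    \<le> norm (cross3 e1 e2) * (\<Sum>i\<in>UNIV. (norm (A $ i - (n \<bullet> A $ i) *\<^sub>R n))\<^sup>2)"
proof -
  let ?w = "cross3 e1 e2" and ?f1 = "A *v e1" and ?f2 = "A *v e2"
  have nn: "n \<bullet> n = 1"
    using w by (simp add: n_def dot_square_norm power2_eq_square)
  \<comment> \<open>Both sides are the squared norm of \<open>cross3 a ?w\<close>: the left by
    Pythagoras for the normal part, the right by expanding the double cross product.\<close>
  have row: "(norm ?w)\<^sup>2 * (norm (a - (n \<bullet> a) *\<^sub>R n))\<^sup>2
      = (norm e1)\<^sup>2 * (a \<bullet> e2)\<^sup>2 + (norm e2)\<^sup>2 * (a \<bullet> e1)\<^sup>2 - 2 * (e1 \<bullet> e2) * ((a \<bullet> e1) * (a \<bullet> e2))" for a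
  proof -
    have "(norm (a - (n \<bullet> a) *\<^sub>R n))\<^sup>2 = (norm a)\<^sup>2 - (n \<bullet> a)\<^sup>2"
      unfolding power2_norm_eq_inner
      by (simp add: inner_diff_left inner_diff_right nn inner_commute power2_eq_square)
    moreover have "(norm ?w)\<^sup>2 * (n \<bullet> a)\<^sup>2 = (a \<bullet> ?w)\<^sup>2"
      using w by (simp add: n_def power_mult_distrib inner_commute field_simps)
    ultimately have "(norm ?w)\<^sup>2 * (norm (a - (n \<bullet> a) *\<^sub>R n))\<^sup>2
        = (norm a * norm ?w)\<^sup>2 - (a \<bullet> ?w)\<^sup>2"
      by (simp add: right_diff_distrib power_mult_distrib)
    also have "\<dots> = (norm (cross3 a ?w))\<^sup>2"
      using norm_cross_dot[of a ?w] by simp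
    finally have "(norm ?w)\<^sup>2 * (norm (a - (n \<bullet> a) *\<^sub>R n))\<^sup>2 = (norm (cross3 a ?w))\<^sup>2" .
    also have "\<dots> = (norm ((a \<bullet> e2) *\<^sub>R e1 - (a \<bullet> e1) *\<^sub>R e2))\<^sup>2"
      by (simp add: Lagrange)
    also have "\<dots> = (norm e1)\<^sup>2 * (a \<bullet> e2)\<^sup>2 + (norm e2)\<^sup>2 * (a \<bullet> e1)\<^sup>2 - 2 * (e1 \<bullet> e2) * ((a \<bullet> e1) * (a \<bullet> e2))"
      unfolding power2_norm_eq_inner
      by (simp add: inner_diff_left inner_diff_right inner_commute power2_eq_square algebra_simps)
    finally show ?thesis .
  qed
  have sq: "(norm (A *v x))\<^sup>2 = (\<Sum>i\<in>UNIV. (A $ i \<bullet> x)\<^sup>2)" for x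
    unfolding power2_norm_eq_inner
    by (simp add: inner_vec_def[of "A *v x"] matrix_vector_mul_component power2_eq_square)
  have "2 * (norm ?w * norm (cross3 ?f1 ?f2))
      \<le> (norm e1 * norm ?f2)\<^sup>2 + (norm e2 * norm ?f1)\<^sup>2 - 2 * (e1 \<bullet> e2) * (?f1 \<bullet> ?f2)"
    by (rule norm_cross_le_mixed)
  also have "\<dots> = (\<Sum>i\<in>UNIV. (norm e1)\<^sup>2 * (A $ i \<bullet> e2)\<^sup>2 + (norm e2)\<^sup>2 * (A $ i \<bullet> e1)\<^sup>2
      - 2 * (e1 \<bullet> e2) * ((A $ i \<bullet> e1) * (A $ i \<bullet> e2)))"
    by (simp add: power_mult_distrib sq inner_vec_def[of ?f1] matrix_vector_mul_component
        sum.distrib sum_subtractf sum_distrib_left)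
  also have "\<dots> = (\<Sum>i\<in>UNIV. (norm ?w)\<^sup>2 * (norm (A $ i - (n \<bullet> A $ i) *\<^sub>R n))\<^sup>2)"
    by (simp only: row)
  also have "\<dots> = norm ?w * (norm ?w * (\<Sum>i\<in>UNIV. (norm (A $ i - (n \<bullet> A $ i) *\<^sub>R n))\<^sup>2))"
    by (simp add: sum_distrib_left power2_eq_square mult.assoc)
  finally have "norm ?w * (2 * norm (cross3 ?f1 ?f2))
      \<le> norm ?w * (norm ?w * (\<Sum>i\<in>UNIV. (norm (A $ i - (n \<bullet> A $ i) *\<^sub>R n))\<^sup>2))"
    by (simp add: algebra_simps)
  then show ?thesis using w by simp
qed

text \<open>The sum is the trace of the projection onto a plane. It gives the equality case of the
  area bound, for the identity map.\<close>

lemma sum_norm_proj_axis: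
  fixes n :: "real^3"
  assumes "norm n = 1"
  shows "(\<Sum>i\<in>UNIV. (norm (axis i 1 - (n \<bullet> axis i 1) *\<^sub>R n))\<^sup>2) = 2"
proof -
  have nn: "n \<bullet> n = 1" using assms by (simp add: dot_square_norm)
  have "(norm (axis i 1 - (n \<bullet> axis i 1) *\<^sub>R n))\<^sup>2 = 1 - (n $ i)\<^sup>2" for i
    unfolding power2_norm_eq_inner
    by (simp add: inner_diff_left inner_diff_right nn inner_commute power2_eq_square inner_axis inner_axis' inner_axis_axis)
  moreover have "(\<Sum>i\<in>UNIV. (n $ i)\<^sup>2) = 1"
    using nn by (simp add: inner_vec_def power2_eq_square)
  ultimately show ?thesis by (simp add: sum_subtractf)
qed

section \<open>Finite element functions on closed triangles\<close>

lemma open_tri_subset: "open_tri M j \<subseteq> closed_tri M j"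
  by (simp add: open_tri_def rel_interior_subset)

lemma closure_open_tri: "closure (open_tri M j) = closed_tri M j"
  unfolding open_tri_def closed_tri_def
  by (subst convex_closure_rel_interior)
    (simp_all add: closure_closed finite_imp_compact_convex_hull compact_imp_closed)

lemma closed_tri_subset_surf: "j \<in> {1..n_tri M} \<Longrightarrow> closed_tri M j \<subseteq> surf M"
  by (auto simp: surf_def)

lemma tri_in_closed_tri: "k \<in> {1..3} \<Longrightarrow> tri M j k \<in> closed_tri M j"
proof -
  assume "k \<in> {1..3}"
  then have "k = 1 \<or> k = 2 \<or> k = 3" by auto
  then show ?thesis unfolding closed_tri_def by (auto intro: hull_inc)
qed

text \<open>The affine formula extends by continuity from the open triangle to its closure, which
  brings in the vertices and boundary segments.\<close>

lemma fe_space_affine: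
  assumes f: "f \<in> fe_space M" and j: "j \<in> {1..n_tri M}"
  shows "\<exists>a b. \<forall>x\<in>closed_tri M j. f x = a \<bullet> x + b"
proof -
  obtain a b where ab: "\<And>x. x \<in> open_tri M j \<Longrightarrow> f x = a \<bullet> x + b"
    using f j unfolding fe_space_def by blast
  have "f x - (a \<bullet> x + b) = 0" if x: "x \<in> closed_tri M j" for x
  proof (rule continuous_constant_on_closure[where S = "open_tri M j" and f = "\<lambda>x. f x - (a \<bullet> x + b)"])
    have "continuous_on (closed_tri M j) f"
      using f closed_tri_subset_surf[OF j] continuous_on_subset by (auto simp: fe_space_def)
    then show "continuous_on (closure (open_tri M j)) (\<lambda>x. f x - (a \<bullet> x + b))"
      unfolding closure_open_tri by (intro continuous_intros)
  qed (use x ab in \<open>simp_all add: closure_open_tri\<close>)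
  then show ?thesis by (intro exI[of _ a] exI[of _ b]) simp
qed

lemma fe_space_vec_component: "X \<in> fe_space_vec M \<Longrightarrow> (\<lambda>x. X x $ i) \<in> fe_space M"
  using exhaust_3[of i] by (auto simp: fe_space_vec_def fe_space_0_def)

lemma fe_space_vec_affine:
  assumes X: "X \<in> fe_space_vec M" and j: "j \<in> {1..n_tri M}"
  shows "\<exists>A b. \<forall>x\<in>closed_tri M j. X x = A *v x + b"
proof -
  have "\<forall>i. \<exists>a b. \<forall>x\<in>closed_tri M j. X x $ i = a \<bullet> x + b"
    using fe_space_affine[OF fe_space_vec_component[OF X] j] by blast
  then obtain a b where ab: "\<And>i x. x \<in> closed_tri M j \<Longrightarrow> X x $ i = a i \<bullet> x + b i"
    by metis
  have "\<forall>x\<in>closed_tri M j. X x = (\<chi> i. a i) *v x + (\<chi> i. b i)"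
    by (simp add: vec_eq_iff matrix_vector_mul_component ab)
  then show ?thesis by blast
qed

text \<open>Makes the displacement an admissible test function; its third component vanishes on the
  boundary because the boundary lies in the plane and \<open>X\<close> keeps it there.\<close>

lemma fe_space_vec_diff_id:
  assumes "polygonal_surface M" "X \<in> fe_space_vec M"
  shows "(\<lambda>x. X x - x) \<in> fe_space_vec M"
proof -
  have comp: "(\<lambda>x. (X x - x) $ i) \<in> fe_space M" for i
  proof -
    have X: "(\<lambda>x. X x $ i) \<in> fe_space M" using assms(2) by (rule fe_space_vec_component)
    have "\<exists>a b. \<forall>x\<in>open_tri M j. (X x - x) $ i = a \<bullet> x + b" if "j \<in> {1..n_tri M}" for j
    proof -
      obtain a b where "\<forall>x\<in>closed_tri M j. X x $ i = a \<bullet> x + b"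
        using fe_space_affine[OF X \<open>j \<in> {1..n_tri M}\<close>] by blast
      then have "\<forall>x\<in>open_tri M j. (X x - x) $ i = (a - axis i 1) \<bullet> x + b"
        using open_tri_subset[of M j] by (auto simp: inner_diff_left inner_axis')
      then show ?thesis by blast
    qed
    moreover have "continuous_on (surf M) (\<lambda>x. (X x - x) $ i)"
      using X by (auto simp: fe_space_def intro!: continuous_intros)
    ultimately show ?thesis by (simp add: fe_space_def)
  qed
  have "x $ 3 = 0" if x: "x \<in> bcurve M" for x :: "real^3"
  proof -
    obtain j where j: "j \<in> {1..n_bseg M}" "x \<in> closed_segment (bseg M j 1) (bseg M j 2)"
      using x by (auto simp: bcurve_def)
    moreover have "bseg M j 1 $ 3 = 0 \<and> bseg M j 2 $ 3 = 0"
      using assms(1) j(1) by (simp add: polygonal_surface_def)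
    ultimately show ?thesis by (auto simp: in_segment)
  qed
  moreover have "\<forall>x\<in>bcurve M. X x $ 3 = 0"
    using assms(2) by (simp add: fe_space_vec_def fe_space_0_def)
  ultimately have "(\<lambda>x. (X x - x) $ 3) \<in> fe_space_0 M"
    using comp[of 3] by (simp add: fe_space_0_def)
  then show ?thesis using comp[of 1] comp[of 2] by (simp add: fe_space_vec_def)
qed

lemma surf_grad_vec_affine:
  assumes M: "polygonal_surface M" and j: "j \<in> {1..n_tri M}" and x: "x \<in> open_tri M j"
    and F: "\<And>y. y \<in> open_tri M j \<Longrightarrow> F y = A *v y + b"
  shows "surf_grad_vec M F x = (\<chi> i. A $ i - (surf_normal M x \<bullet> A $ i) *\<^sub>R surf_normal M x)"
  unfolding surf_grad_vec_def
proof (intro arg_cong[where f = vec_lambda] ext)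
  fix i
  show "surf_grad M (\<lambda>y. F y $ i) x = A $ i - (surf_normal M x \<bullet> A $ i) *\<^sub>R surf_normal M x"
    by (rule surf_grad_affine[OF M j x, of _ _ "b $ i"]) (simp add: F matrix_vector_mul_component)
qed

lemma surf_area_image_mesh_diff_le:
  assumes M: "polygonal_surface M" and X: "X \<in> fe_space_vec M"
  shows "surf_area (image_mesh X M) - surf_area M
    \<le> surf_inner M (surf_grad_vec M X) (surf_grad_vec M (\<lambda>x. X x - x))"
proof -
  have "\<forall>j\<in>{1..n_tri M}. \<exists>A b. \<forall>x\<in>closed_tri M j. X x = A *v x + b"
    using fe_space_vec_affine[OF X] by blast
  then obtain A b where Ab: "\<And>j x. j \<in> {1..n_tri M} \<Longrightarrow> x \<in> closed_tri M j \<Longrightarrow> X x = A j *v x + b j"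
    by metis
  define w where "w j = cross3 (tri M j 2 - tri M j 1) (tri M j 3 - tri M j 1)" for j
  define n where "n j = w j /\<^sub>R norm (w j)" for j
  define P where "P j v = v - (n j \<bullet> v) *\<^sub>R n j" for j v
  \<comment> \<open>The constant value of the Frobenius product on triangle \<open>j\<close>: the
    rows of the two gradients are the projected rows of \<open>A j\<close> and of
    \<open>A j - mat 1\<close>.\<close>
  define c where "c j = (\<Sum>i\<in>UNIV. P j (A j $ i) \<bullet> (P j (A j $ i) - P j (axis i 1)))" for j
  have sn: "surf_normal M x = n j" if "j \<in> {1..n_tri M}" "x \<in> open_tri M j" for j x
    using tri_of_eq[OF M that] by (simp add: surf_normal_def n_def w_def Let_def)
  have "surf_inner M (surf_grad_vec M X) (surf_grad_vec M (\<lambda>x. X x - x)) = (\<Sum>j = 1..n_tri M. tri_area M j * c j)"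
    unfolding surf_inner_def
  proof (rule surf_integral_piecewise_const[OF M])
    fix j x assume j: "j \<in> {1..n_tri M}" and x: "x \<in> open_tri M j"
    have "surf_grad_vec M X x = (\<chi> i. P j (A j $ i))"
      unfolding P_def sn[OF j x, symmetric]
      using open_tri_subset[of M j] by (intro surf_grad_vec_affine[OF M j x, of _ _ "b j"]) (auto simp: Ab[OF j])
    moreover have "surf_grad_vec M (\<lambda>x. X x - x) x = (\<chi> i. P j ((A j - mat 1) $ i))"
      unfolding P_def sn[OF j x, symmetric]
      using open_tri_subset[of M j]
      by (intro surf_grad_vec_affine[OF M j x, of _ _ "b j"])
        (auto simp: Ab[OF j] matrix_vector_mult_diff_rdistrib)
    moreover have "P j ((A j - mat 1) $ i) = P j (A j $ i) - P j (axis i 1)" for i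
    proof -
      have "(A j - mat 1) $ i = A j $ i - axis i 1"
        by (simp add: vec_eq_iff mat_def axis_def)
      then show ?thesis by (simp add: P_def inner_diff_right scaleR_diff_left)
    qed
    ultimately show "surf_grad_vec M X x \<bullet> surf_grad_vec M (\<lambda>x. X x - x) x = c j"
      by (simp add: c_def inner_vec_def[where ?'a = "real^3"])
  qed
  moreover have "tri_area (image_mesh X M) j - tri_area M j \<le> tri_area M j * c j"
    if j: "j \<in> {1..n_tri M}" for j
  proof -
    have "\<not> collinear {tri M j 1, tri M j 2, tri M j 3}"
      using M j by (simp add: polygonal_surface_def)
    then have w: "w j \<noteq> 0" by (simp add: w_def cross_eq_0_iff_collinear)
    have img: "X (tri M j k) - X (tri M j 1) = A j *v (tri M j k - tri M j 1)" if "k \<in> {1..3}" for k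
      using Ab[OF j tri_in_closed_tri[OF that]] Ab[OF j tri_in_closed_tri[of 1]]
      by (simp add: matrix_vector_mult_diff_distrib)
    have "tri_area (image_mesh X M) j
        = norm (cross3 (A j *v (tri M j 2 - tri M j 1)) (A j *v (tri M j 3 - tri M j 1))) / 2"
      using img[of 2] img[of 3] by (simp add: tri_area_def image_mesh_def)
    also have "\<dots> \<le> tri_area M j * ((\<Sum>i\<in>UNIV. (norm (P j (A j $ i)))\<^sup>2) / 2)"
      using norm_cross_image_le[of "tri M j 2 - tri M j 1" "tri M j 3 - tri M j 1" "A j"] w
      by (simp add: tri_area_def P_def n_def w_def)
    finally have img_area: "tri_area (image_mesh X M) j
        \<le> tri_area M j * ((\<Sum>i\<in>UNIV. (norm (P j (A j $ i)))\<^sup>2) / 2)" .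
    \<comment> \<open>The right side exceeds the left by half the squared norm of
      \<open>u - v\<close>; this is the convexity inequality for the energy.\<close>
    have young: "(norm u)\<^sup>2 / 2 - (norm v)\<^sup>2 / 2 \<le> u \<bullet> (u - v)" for u v :: "real^3"
    proof -
      have "0 \<le> (norm (u - v))\<^sup>2" by simp
      then show ?thesis
        unfolding power2_norm_eq_inner
        by (simp add: inner_diff_left inner_diff_right inner_commute)
    qed
    have "norm (n j) = 1" using w by (simp add: n_def)
    then have "(\<Sum>i\<in>UNIV. (norm (P j (axis i 1)))\<^sup>2) = 2"
      unfolding P_def by (rule sum_norm_proj_axis)
    \<comment> \<open>The subtracted 1 is half the energy density of the identity, so it accounts
      for the old area.\<close>
    then have "(\<Sum>i\<in>UNIV. (norm (P j (A j $ i)))\<^sup>2) / 2 - 1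
        = (\<Sum>i\<in>UNIV. (norm (P j (A j $ i)))\<^sup>2 / 2 - (norm (P j (axis i 1)))\<^sup>2 / 2)"
      by (simp add: sum_subtractf flip: sum_divide_distrib)
    also have "\<dots> \<le> c j"
      unfolding c_def by (intro sum_mono young)
    finally have "tri_area M j * ((\<Sum>i\<in>UNIV. (norm (P j (A j $ i)))\<^sup>2) / 2 - 1) \<le> tri_area M j * c j"
      by (intro mult_left_mono) (simp_all add: tri_area_def)
    then show ?thesis using img_area by (simp add: algebra_simps)
  qed
  then have "surf_area (image_mesh X M) - surf_area M \<le> (\<Sum>j = 1..n_tri M. tri_area M j * c j)"
    by (subst (1 2) surf_area_def, subst image_mesh_def)
      (auto simp flip: sum_subtractf intro!: sum_mono)
  ultimately show ?thesis by simp
qed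

text \<open>The two equations of the scheme share one lumped product, up to the order of the
  arguments and the factor \<open>1 / \<tau>\<close>. The factor leaves the vertex limits since
  \<open>F\<close> is continuous; the limits of \<open>G\<close> are the same terms on both
  sides.\<close>

lemma lumped_inner_swap_scale:
  fixes F G :: "real^3 \<Rightarrow> 'a::real_inner"
  assumes M: "polygonal_surface M" and F: "continuous_on (surf M) F"
  shows "lumped_inner M (\<lambda>x. F x /\<^sub>R \<tau>) G = lumped_inner M G F / \<tau>"
proof -
  have L: "Lim (at (tri M j k) within open_tri M j) (\<lambda>x. F x /\<^sub>R \<tau>)
      = Lim (at (tri M j k) within open_tri M j) F /\<^sub>R \<tau>"
    if j: "j \<in> {1..n_tri M}" and k: "k \<in> {1..3}" for j k
  proof -
    let ?q = "tri M j k" and ?O = "open_tri M j"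
    have q: "?q \<in> closed_tri M j" by (rule tri_in_closed_tri[OF k])
    have nc: "\<not> collinear {tri M j 1, tri M j 2, tri M j 3}"
      using M j by (simp add: polygonal_surface_def)
    have "closed_tri M j \<noteq> {z}" for z
      using tri_in_closed_tri[of 1 M j] tri_in_closed_tri[of 2 M j] nc by auto
    \<comment> \<open>A connected set with more than one point has no isolated points; this makes
      the filter at the vertex nontrivial, so \<open>Lim\<close> returns the actual limit.\<close>
    then have "?q islimpt closed_tri M j"
      using q by (intro connected_imp_perfect) (auto simp: closed_tri_def intro!: convex_connected)
    then have "?q islimpt ?O"
      by (simp add: limpt_of_closure flip: closure_open_tri)
    then have nt: "\<not> trivial_limit (at ?q within ?O)" by (simp add: trivial_limit_within)
    have "(F \<longlongrightarrow> F ?q) (at ?q within surf M)"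
      using F q closed_tri_subset_surf[OF j] by (auto simp: continuous_on)
    then have lim: "(F \<longlongrightarrow> F ?q) (at ?q within ?O)"
      by (rule tendsto_within_subset) (use open_tri_subset[of M j] closed_tri_subset_surf[OF j] in blast)
    have "((\<lambda>x. F x /\<^sub>R \<tau>) \<longlongrightarrow> F ?q /\<^sub>R \<tau>) (at ?q within ?O)"
      by (intro tendsto_intros lim)
    then show ?thesis
      using tendsto_Lim[OF nt] lim by metis
  qed
  let ?L = "\<lambda>j k. Lim (at (tri M j k) within open_tri M j)"
  have "(\<Sum>j = 1..n_tri M. \<Sum>k = 1..3. tri_area M j * (?L j k (\<lambda>x. F x /\<^sub>R \<tau>) \<bullet> ?L j k G))
      = (\<Sum>j = 1..n_tri M. \<Sum>k = 1..3. tri_area M j * (?L j k G \<bullet> ?L j k F) / \<tau>)"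
    by (intro sum.cong refl) (simp only: L, simp add: inner_commute divide_inverse mult_ac)
  then show ?thesis
    unfolding lumped_inner_def by (simp flip: sum_divide_distrib)
qed

section \<open>The boundary term\<close>

lemma linear_to_plane: "linear to_plane"
  by (simp add: linear_iff to_plane_def complex_eq_iff)

lemma zip_map_rotate1:
  "zip (map f vs) (rotate1 (map f vs)) = map (map_prod f f) (zip vs (rotate1 vs))"
  by (simp add: rotate1_map zip_map_map map_prod_def)

lemma polygon_edges_distinct:
  assumes "distinct vs" "2 \<le> length vs" "(a, b) \<in> set (zip vs (rotate1 vs))"
  shows "a \<noteq> b"
proof -
  obtain k where k: "k < length vs" "a = vs ! k" "b = rotate1 vs ! k"
    using assms(3) by (auto simp: in_set_zip)
  have "b = vs ! (Suc k mod length vs)"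
    using k by (simp add: nth_rotate1)
  moreover have "Suc k mod length vs \<noteq> k"
    using k(1) assms(2) by (simp add: mod_Suc)
  moreover have "Suc k mod length vs < length vs"
    using k(1) by (intro mod_less_divisor) linarith
  ultimately show ?thesis
    using k(2) nth_eq_iff_index_eq[OF assms(1) k(1), of "Suc k mod length vs"] by simp
qed

text \<open>The \<open>n_bseg M\<close> labels are mapped onto the edges of a polygon with equally
  many distinct vertices, so by counting the labelling is injective, and sums over labels become
  sums along the curve.\<close>

lemma polygonal_surface_boundary:
  assumes "polygonal_surface M"
  obtains vs where "positive_polygon (map to_plane vs)"
    "(\<lambda>j. (bseg M j 1, bseg M j 2)) ` {1..n_bseg M} = set (zip vs (rotate1 vs))"
    "inj_on (\<lambda>j. (bseg M j 1, bseg M j 2)) {1..n_bseg M}"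
    "\<And>h :: real^3 \<Rightarrow> real^3 \<Rightarrow> real.
      (\<Sum>j = 1..n_bseg M. h (bseg M j 1) (bseg M j 2)) = (\<Sum>(a, b)\<leftarrow>zip vs (rotate1 vs). h a b)"
proof -
  let ?f = "\<lambda>j. (bseg M j 1, bseg M j 2)"
  have "\<exists>vs. length vs = n_bseg M \<and> ?f ` {1..n_bseg M} = set (zip vs (rotate1 vs)) \<and>
      positive_polygon (map to_plane vs)"
    using assms unfolding polygonal_surface_def by (elim conjE)
  then obtain vs where vs: "length vs = n_bseg M" "?f ` {1..n_bseg M} = set (zip vs (rotate1 vs))"
      "positive_polygon (map to_plane vs)"
    by (elim exE conjE)
  have "distinct vs"
    using positive_polygonD(2)[OF vs(3)] by (simp add: distinct_map)
  then have d: "distinct (zip vs (rotate1 vs))" by (rule distinct_zipI1)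
  have inj: "inj_on ?f {1..n_bseg M}"
    by (rule eq_card_imp_inj_on) (simp_all only: vs(2) distinct_card[OF d], simp_all add: vs(1))
  have "(\<Sum>j = 1..n_bseg M. h (bseg M j 1) (bseg M j 2)) = (\<Sum>(a, b)\<leftarrow>zip vs (rotate1 vs). h a b)"
    for h :: "real^3 \<Rightarrow> real^3 \<Rightarrow> real"
  proof -
    have "(\<Sum>(a, b)\<leftarrow>zip vs (rotate1 vs). h a b) = (\<Sum>(a, b)\<in>set (zip vs (rotate1 vs)). h a b)"
      using d by (simp only: sum_list_distinct_conv_sum_set)
    also have "\<dots> = (\<Sum>j\<in>{1..n_bseg M}. case ?f j of (a, b) \<Rightarrow> h a b)"
      by (simp only: vs(2)[symmetric] sum.reindex[OF inj] o_def)
    finally show ?thesis by simp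
  qed
  then show ?thesis by (rule that[OF vs(3,2) inj])
qed

lemma sum_bseg_telescope:
  fixes \<phi> :: "real^3 \<Rightarrow> real"
  assumes "polygonal_surface M"
  shows "(\<Sum>j = 1..n_bseg M. \<phi> (bseg M j 2) - \<phi> (bseg M j 1)) = 0"
proof -
  obtain vs where sum: "\<And>h :: real^3 \<Rightarrow> real^3 \<Rightarrow> real.
      (\<Sum>j = 1..n_bseg M. h (bseg M j 1) (bseg M j 2)) = (\<Sum>(a, b)\<leftarrow>zip vs (rotate1 vs). h a b)"
    by (rule polygonal_surface_boundary[OF assms]) blast
  from sum[of "\<lambda>a b. \<phi> b - \<phi> a"] show ?thesis
    by (simp add: sum_list_zip_rotate1_telescope)
qed

lemma enclosed_area_shoelace:
  assumes "polygonal_surface M"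
  shows "enclosed_area M
    = (\<Sum>j = 1..n_bseg M. bseg M j 1 $ 1 * bseg M j 2 $ 2 - bseg M j 1 $ 2 * bseg M j 2 $ 1) / 2"
proof -
  obtain vs where pos: "positive_polygon (map to_plane vs)"
    and img: "(\<lambda>j. (bseg M j 1, bseg M j 2)) ` {1..n_bseg M} = set (zip vs (rotate1 vs))"
    and sum: "\<And>h :: real^3 \<Rightarrow> real^3 \<Rightarrow> real.
      (\<Sum>j = 1..n_bseg M. h (bseg M j 1) (bseg M j 2)) = (\<Sum>(a, b)\<leftarrow>zip vs (rotate1 vs). h a b)"
    by (rule polygonal_surface_boundary[OF assms]) blast
  let ?ws = "map to_plane vs"
  have ne: "?ws \<noteq> []" using positive_polygonD(1)[OF pos] by auto
  note zip = zip_map_rotate1[of to_plane vs]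
  have "path_image (polyline (?ws @ [hd ?ws])) = (\<Union>(a, b)\<in>set (zip ?ws (rotate1 ?ws)). closed_segment a b)"
    unfolding zip_rotate1_eq[OF ne]
    by (rule path_image_polyline) (use positive_polygonD(1)[OF pos] in simp)
  also have "\<dots> = (\<Union>(a, b)\<in>set (zip vs (rotate1 vs)). closed_segment (to_plane a) (to_plane b))"
    unfolding zip by auto
  also have "\<dots> = to_plane ` bcurve M"
    by (simp add: img[symmetric] bcurve_def image_UN closed_segment_linear_image[OF linear_to_plane])
  finally have "enclosed_area M = measure lebesgue (inside (path_image (polyline (?ws @ [hd ?ws]))))"
    by (simp add: enclosed_area_def)
  also have "\<dots> = (\<Sum>(a, b)\<leftarrow>zip ?ws (rotate1 ?ws). Im (cnj a * b)) / 2"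
    by (rule measure_inside_positive_polygon[OF pos])
  also have "(\<Sum>(a, b)\<leftarrow>zip ?ws (rotate1 ?ws). Im (cnj a * b))
      = (\<Sum>(a, b)\<leftarrow>zip vs (rotate1 vs). a $ 1 * b $ 2 - a $ 2 * b $ 1)"
    unfolding zip by (simp add: to_plane_def case_prod_unfold comp_def)
  also have "\<dots> = (\<Sum>j = 1..n_bseg M. bseg M j 1 $ 1 * bseg M j 2 $ 2 - bseg M j 1 $ 2 * bseg M j 2 $ 1)"
    by (rule sum[of "\<lambda>(a :: real^3) (b :: real^3). a $ 1 * b $ 2 - a $ 2 * b $ 1", symmetric])
  finally show ?thesis .
qed

lemma bseg_endpoints_distinct:
  assumes "polygonal_surface M" "j \<in> {1..n_bseg M}"
  shows "to_plane (bseg M j 1) \<noteq> to_plane (bseg M j 2)"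
proof -
  obtain vs where pos: "positive_polygon (map to_plane vs)"
    and img: "(\<lambda>j. (bseg M j 1, bseg M j 2)) ` {1..n_bseg M} = set (zip vs (rotate1 vs))"
    by (rule polygonal_surface_boundary[OF assms(1)]) blast
  have "(bseg M j 1, bseg M j 2) \<in> set (zip vs (rotate1 vs))"
    using assms(2) by (simp flip: img)
  then have "(to_plane (bseg M j 1), to_plane (bseg M j 2))
      \<in> set (zip (map to_plane vs) (rotate1 (map to_plane vs)))"
    unfolding zip_map_rotate1 by (auto intro: rev_image_eqI)
  then show ?thesis
    by (rule polygon_edges_distinct[OF positive_polygonD(2,1)[OF pos]])
qed

text \<open>A second label of the same point would occupy another position in the edge list, and the
  projected point would lie in two open edges of a simple polygon.\<close>

lemma bseg_of_eq:
  assumes M: "polygonal_surface M" and j: "j \<in> {1..n_bseg M}"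
    and x: "x \<in> open_segment (bseg M j 1) (bseg M j 2)"
  shows "bseg_of M x = j"
  unfolding bseg_of_def
proof (rule the_equality)
  fix i assume i: "i \<in> {1..n_bseg M} \<and> x \<in> open_segment (bseg M i 1) (bseg M i 2)"
  show "i = j"
  proof (rule ccontr)
    assume "i \<noteq> j"
    let ?f = "\<lambda>j. (bseg M j 1, bseg M j 2)"
    obtain vs where pos: "positive_polygon (map to_plane vs)"
      and img: "?f ` {1..n_bseg M} = set (zip vs (rotate1 vs))"
      and inj: "inj_on ?f {1..n_bseg M}"
      by (rule polygonal_surface_boundary[OF M]) blast
    let ?E = "zip vs (rotate1 vs)"
    let ?E' = "zip (map to_plane vs) (rotate1 (map to_plane vs))"
    have E': "?E' ! k = map_prod to_plane to_plane (?E ! k)" if "k < length ?E" for k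
      unfolding zip_map_rotate1 using that by (rule nth_map)
    have edge: "?f m \<in> set ?E" if "m \<in> {1..n_bseg M}" for m
      unfolding img[symmetric] by (rule image_eqI[OF refl that])
    obtain k l where k: "k < length ?E" "?E ! k = ?f i" and l: "l < length ?E" "?E ! l = ?f j"
      using edge[OF conjunct1[OF i]] edge[OF j] unfolding in_set_conv_nth by blast
    have "k \<noteq> l"
    proof
      assume "k = l"
      then have "?f i = ?f j" using k(2) l(2) by simp
      then show False using inj_onD[OF inj _ conjunct1[OF i] j] \<open>i \<noteq> j\<close> by blast
    qed
    \<comment> \<open>An open segment maps into an open segment only because the projected endpoints
      stay distinct.\<close>
    have proj: "to_plane x \<in> open_segment (to_plane (bseg M m 1)) (to_plane (bseg M m 2))"
      if "m \<in> {1..n_bseg M}" "x \<in> open_segment (bseg M m 1) (bseg M m 2)" for m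
      using bseg_endpoints_distinct[OF M that(1)] that(2)
      by (auto simp: in_segment linear_add[OF linear_to_plane] linear_scale[OF linear_to_plane])
    have disj: "open_segment (fst (?E' ! p)) (snd (?E' ! p)) \<inter> open_segment (fst (?E' ! q)) (snd (?E' ! q)) = {}"
      if "p < q" "q < length ?E" for p q
      using sorted_wrt_nth_less[OF positive_polygonD(3)[OF pos] that(1)] that(2)
      by (simp add: case_prod_unfold)
    have "to_plane x \<in> open_segment (fst (?E' ! k)) (snd (?E' ! k))"
      "to_plane x \<in> open_segment (fst (?E' ! l)) (snd (?E' ! l))"
      unfolding E'[OF k(1)] E'[OF l(1)] k(2) l(2) using proj i j x by simp_all
    then show False
      using disj[OF _ l(1), of k] disj[OF _ k(1), of l] \<open>k \<noteq> l\<close>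
      by (cases k l rule: linorder_cases) blast+
  qed
qed (use j x in blast)

section \<open>Integrals and arc length derivatives along the boundary\<close>

lemma LINT_affine_unit_interval:
  "(LINT t:{0<..<1}|lborel. r + t * s) = r + s / (2 :: real)"
proof -
  have "(LINT t:{0<..<1}|lborel. r + t * s) = (LBINT t=ereal 0..ereal 1. r + t * s)"
    by (subst interval_integral_Ioo) (simp_all add: zero_ereal_def one_ereal_def)
  also have "\<dots> = (r * 1 + 1\<^sup>2 / 2 * s) - (r * 0 + 0\<^sup>2 / 2 * s)"
    by (rule interval_integral_FTC_finite[where F = "\<lambda>t. r * t + t\<^sup>2 / 2 * s"])
      (auto intro!: continuous_intros derivative_eq_intros
        simp flip: has_real_derivative_iff_has_vector_derivative)
  finally show ?thesis by simp
qed

lemma bseg_subset_closed_tri: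
  assumes M: "polygonal_surface M" and j: "j \<in> {1..n_bseg M}"
  obtains i where "i \<in> {1..n_tri M}" "closed_segment (bseg M j 1) (bseg M j 2) \<subseteq> closed_tri M i"
proof -
  have "(\<lambda>j. {bseg M j 1, bseg M j 2}) ` {1..n_bseg M}
       = {e. \<exists>!j. j \<in> {1..n_tri M} \<and> e \<in> tri_edges M j}"
    using M by (simp add: polygonal_surface_def)
  then have "{bseg M j 1, bseg M j 2} \<in> {e. \<exists>!j. j \<in> {1..n_tri M} \<and> e \<in> tri_edges M j}"
    using j by blast
  then obtain i where i: "i \<in> {1..n_tri M}" "{bseg M j 1, bseg M j 2} \<in> tri_edges M i"
    by blast
  then have "{bseg M j 1, bseg M j 2} \<subseteq> {tri M i 1, tri M i 2, tri M i 3}"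
    unfolding tri_edges_def by fast
  then have "closed_segment (bseg M j 1) (bseg M j 2) \<subseteq> closed_tri M i"
    unfolding segment_convex_hull closed_tri_def by (rule hull_mono)
  then show ?thesis using that i(1) by blast
qed

lemma fe_space_vec_affine_bseg:
  assumes M: "polygonal_surface M" and X: "X \<in> fe_space_vec M" and j: "j \<in> {1..n_bseg M}"
    and t: "0 \<le> t" "t \<le> 1"
  shows "X (bseg M j 1 + t *\<^sub>R (bseg M j 2 - bseg M j 1))
    = X (bseg M j 1) + t *\<^sub>R (X (bseg M j 2) - X (bseg M j 1))"
proof -
  obtain i where i: "i \<in> {1..n_tri M}" "closed_segment (bseg M j 1) (bseg M j 2) \<subseteq> closed_tri M i"
    using bseg_subset_closed_tri[OF M j] .
  obtain A b where Ab: "\<And>x. x \<in> closed_tri M i \<Longrightarrow> X x = A *v x + b"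
    using fe_space_vec_affine[OF X i(1)] by blast
  have "bseg M j 1 + t *\<^sub>R (bseg M j 2 - bseg M j 1) \<in> closed_segment (bseg M j 1) (bseg M j 2)"
    using t by (auto simp: in_segment algebra_simps intro!: exI[of _ t])
  then have "X (bseg M j 1 + t *\<^sub>R (bseg M j 2 - bseg M j 1)) = A *v (bseg M j 1 + t *\<^sub>R (bseg M j 2 - bseg M j 1)) + b"
    using i(2) Ab by blast
  moreover have "X (bseg M j 1) = A *v bseg M j 1 + b" "X (bseg M j 2) = A *v bseg M j 2 + b"
    using i(2) by (auto intro!: Ab)
  ultimately show ?thesis
    by (simp add: matrix_vector_right_distrib matrix_vector_mult_diff_distrib matrix_vector_mult_scaleR)
qed

lemma arc_deriv_bseg:
  assumes M: "polygonal_surface M" and j: "j \<in> {1..n_bseg M}" and t: "0 < t" "t < 1"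
    and F: "\<And>s. 0 \<le> s \<Longrightarrow> s \<le> 1 \<Longrightarrow> F (bseg M j 1 + s *\<^sub>R (bseg M j 2 - bseg M j 1))
      = F (bseg M j 1) + s *\<^sub>R (F (bseg M j 2) - F (bseg M j 1))"
  shows "arc_deriv M F (bseg M j 1 + t *\<^sub>R (bseg M j 2 - bseg M j 1))
    = (F (bseg M j 2) - F (bseg M j 1)) /\<^sub>R norm (bseg M j 2 - bseg M j 1)"
proof -
  let ?p = "bseg M j 1" and ?d = "bseg M j 2 - bseg M j 1"
  let ?l = "norm ?d" and ?D = "F (bseg M j 2) - F (bseg M j 1)"
  have ne: "bseg M j 1 \<noteq> bseg M j 2" using bseg_endpoints_distinct[OF M j] by auto
  then have l: "0 < ?l" by simp
  have "?p + t *\<^sub>R ?d \<in> open_segment (bseg M j 1) (bseg M j 2)"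
    using t ne by (auto simp: in_segment algebra_simps intro!: exI[of _ t])
  then have b: "bseg_of M (?p + t *\<^sub>R ?d) = j" by (rule bseg_of_eq[OF M j])
  have "((\<lambda>s. F (?p + t *\<^sub>R ?d + s *\<^sub>R (?d /\<^sub>R ?l))) has_vector_derivative (?D /\<^sub>R ?l)) (at 0)"
  \<comment> \<open>The arc lengths \<open>s\<close> for which the point stays in the open segment;
    there its affine coordinate is \<open>t + s / ?l\<close>.\<close>
  proof (rule has_vector_derivative_transform_within_open[where S = "{- t * ?l<..<(1 - t) * ?l}"])
    show "((\<lambda>s. F ?p + (t + s / ?l) *\<^sub>R ?D) has_vector_derivative (?D /\<^sub>R ?l)) (at 0)"
      using l by (auto intro!: derivative_eq_intros simp: divide_inverse)
    show "0 \<in> {- t * ?l<..<(1 - t) * ?l}" using t l by simp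
    fix s assume s: "s \<in> {- t * ?l<..<(1 - t) * ?l}"
    have "0 \<le> t + s / ?l" "t + s / ?l \<le> 1"
      using s l by (auto simp: field_simps)
    from F[OF this] show "F ?p + (t + s / ?l) *\<^sub>R ?D = F (?p + t *\<^sub>R ?d + s *\<^sub>R (?d /\<^sub>R ?l))"
      by (simp add: scaleR_left_distrib divide_inverse add.assoc)
  qed simp
  then show ?thesis
    unfolding arc_deriv_def b Let_def by (rule vector_derivative_at)
qed

lemma cross_e_z_inner: "cross3 u e_z \<bullet> v = u $ 2 * v $ 1 - u $ 1 * v $ 2"
  by (simp add: cross3_def e_z_def inner_vec_def sum_3 algebra_simps)

lemma bdry_inner_normal_half:
  assumes M: "polygonal_surface M" and M': "polygonal_surface (image_mesh X M)"
    and X: "X \<in> fe_space_vec M"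
  shows "bdry_inner M (bdry_normal_half M X) (\<lambda>x. X x - x)
    = enclosed_area (image_mesh X M) - enclosed_area M"
proof -
  let ?p = "\<lambda>j. bseg M j 1" and ?q = "\<lambda>j. bseg M j 2"
  let ?d = "\<lambda>j. ?q j - ?p j" and ?D = "\<lambda>j. X (?q j) - X (?p j)"
  let ?g = "\<lambda>x. X x - x"
  define sh :: "real^3 \<Rightarrow> real^3 \<Rightarrow> real" where "sh a b = a $ 1 * b $ 2 - a $ 2 * b $ 1" for a b
  \<comment> \<open>Expanding the boundary term by bilinearity, the products of an old endpoint with
    the image of the other endpoint cancel by antisymmetry. Those of a vertex with its own image
    remain, and \<open>\<phi>\<close> collects them.\<close>
  define \<phi> where "\<phi> x = - sh x (X x) / 2" for x
  \<comment> \<open>On a segment the averaged normal is constant and the displacement affine, so the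
    integral takes the mean of the endpoint values. The 4 combines this mean with the time
    average.\<close>
  have "norm (?d j) * (LINT t:{0<..<1}|lborel.
        bdry_normal_half M X (?p j + t *\<^sub>R ?d j) \<bullet> ?g (?p j + t *\<^sub>R ?d j))
    = cross3 (?d j + ?D j) e_z \<bullet> (?g (?p j) + ?g (?q j)) / 4"
    if j: "j \<in> {1..n_bseg M}" for j
  proof -
    have "0 < norm (?d j)" using bseg_endpoints_distinct[OF M j] by auto
    have half: "bdry_normal_half M X (?p j + t *\<^sub>R ?d j) = cross3 (?d j + ?D j) e_z /\<^sub>R (2 * norm (?d j))"
      if t: "0 < t" "t < 1" for t
    proof -
      have "arc_deriv M X (?p j + t *\<^sub>R ?d j) = ?D j /\<^sub>R norm (?d j)"
        by (rule arc_deriv_bseg[OF M j t fe_space_vec_affine_bseg[OF M X j]])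
      moreover have "arc_deriv M (\<lambda>y. y) (?p j + t *\<^sub>R ?d j) = ?d j /\<^sub>R norm (?d j)"
        by (rule arc_deriv_bseg[OF M j t]) simp
      ultimately show ?thesis
        by (simp add: bdry_normal_half_def cross_mult_left flip: scaleR_right_distrib)
    qed
    have g: "?g (?p j + t *\<^sub>R ?d j) = ?g (?p j) + t *\<^sub>R (?g (?q j) - ?g (?p j))" if "0 < t" "t < 1" for t
      using fe_space_vec_affine_bseg[OF M X j, of t] that by (simp add: algebra_simps)
    let ?c = "cross3 (?d j + ?D j) e_z /\<^sub>R (2 * norm (?d j))"
    have "(LINT t:{0<..<1}|lborel. bdry_normal_half M X (?p j + t *\<^sub>R ?d j) \<bullet> ?g (?p j + t *\<^sub>R ?d j))
        = (LINT t:{0<..<1}|lborel. ?c \<bullet> ?g (?p j) + t * (?c \<bullet> (?g (?q j) - ?g (?p j))))"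
    proof (rule set_lebesgue_integral_cong, simp, intro allI impI)
      fix t :: real assume "t \<in> {0<..<1}"
      then show "bdry_normal_half M X (?p j + t *\<^sub>R ?d j) \<bullet> ?g (?p j + t *\<^sub>R ?d j)
          = ?c \<bullet> ?g (?p j) + t * (?c \<bullet> (?g (?q j) - ?g (?p j)))"
        by (simp only: half g greaterThanLessThan_iff inner_add_right inner_scaleR_right)
    qed
    also have "\<dots> = ?c \<bullet> ?g (?p j) + (?c \<bullet> (?g (?q j) - ?g (?p j))) / 2"
      by (rule LINT_affine_unit_interval)
    also have "\<dots> = ?c \<bullet> (?g (?p j) + ?g (?q j)) / 2"
      by (simp only: inner_add_right inner_diff_right) (simp add: field_simps)
    finally show ?thesis
      using \<open>0 < norm (?d j)\<close> by (simp add: field_simps)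
  qed
  then have "bdry_inner M (bdry_normal_half M X) ?g
      = (\<Sum>j = 1..n_bseg M. cross3 (?d j + ?D j) e_z \<bullet> (?g (?p j) + ?g (?q j)) / 4)"
    unfolding bdry_inner_def bdry_integral_def by (intro sum.cong refl) blast
  also have "\<dots> = (\<Sum>j = 1..n_bseg M.
      (sh (X (?p j)) (X (?q j)) - sh (?p j) (?q j)) / 2 + (\<phi> (?q j) - \<phi> (?p j)))"
    unfolding cross_e_z_inner \<phi>_def sh_def by (intro sum.cong refl) (simp add: field_simps)
  also have "\<dots> = (\<Sum>j = 1..n_bseg M. (sh (X (?p j)) (X (?q j)) - sh (?p j) (?q j)) / 2)"
    unfolding sum.distrib using sum_bseg_telescope[OF M, of \<phi>] by simp
  also have "\<dots> = enclosed_area (image_mesh X M) - enclosed_area M"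
    unfolding enclosed_area_shoelace[OF M] enclosed_area_shoelace[OF M']
    by (simp add: image_mesh_def sh_def sum_subtractf flip: sum_divide_distrib)
      (simp add: diff_divide_distrib)
  finally show ?thesis .
qed

section \<open>Energy decay\<close>

text \<open>A non-integrable integrand has integral 0 by convention, so the squared norms below
  unfold for arbitrary functions.\<close>

lemma LINT_nonneg: "(\<And>x. 0 \<le> f x) \<Longrightarrow> 0 \<le> (LINT x:A|M. f x)" for f :: "'a \<Rightarrow> real"
  unfolding set_lebesgue_integral_def by (intro integral_nonneg_AE AE_I2) simp

lemma surf_norm_power2: "(surf_norm M f)\<^sup>2 = surf_inner M f f"
  unfolding surf_norm_def surf_inner_def surf_integral_def
  by (intro real_sqrt_pow2 sum_nonneg mult_nonneg_nonneg LINT_nonneg) (simp_all add: tri_area_def)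

lemma bdry_norm_power2: "(bdry_norm M f)\<^sup>2 = bdry_inner M f f"
  unfolding bdry_norm_def bdry_inner_def bdry_integral_def
  by (intro real_sqrt_pow2 sum_nonneg mult_nonneg_nonneg LINT_nonneg) simp_all

lemma bdry_inner_divide:
  fixes f :: "real^3 \<Rightarrow> real"
  shows "bdry_inner M (\<lambda>x. f x / c) (\<lambda>x. f x / c) = bdry_inner M f f / c\<^sup>2"
proof -
  have "f x / c * (f x / c) = inverse (c\<^sup>2) * (f x * f x)" for x
    by (simp add: power2_eq_square divide_inverse)
  then have "bdry_inner M (\<lambda>x. f x / c) (\<lambda>x. f x / c) = inverse (c\<^sup>2) * bdry_inner M f f"
    by (simp add: bdry_inner_def bdry_integral_def sum_distrib_left mult.left_commute)
  then show ?thesis by (simp add: divide_inverse)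
qed

lemma energy_step:
  assumes \<tau>: "\<tau> > 0"
    and M: "polygonal_surface M" and M': "polygonal_surface (image_mesh X M)"
    and step: "scheme_step \<tau> \<eta> \<theta> M X H"
  shows "(surf_norm M (surf_grad M H))\<^sup>2
      + 1 / \<eta> * (bdry_norm M (\<lambda>x. ((X x - x) /\<^sub>R \<tau>) \<bullet> bdry_normal M x))\<^sup>2
    \<le> ((surf_area M - cos \<theta> * enclosed_area M)
        - (surf_area (image_mesh X M) - cos \<theta> * enclosed_area (image_mesh X M))) / \<tau>"
proof -
  let ?g = "\<lambda>x. X x - x"
  let ?L = "lumped_inner M (\<lambda>x. H x *\<^sub>R surf_normal M x) ?g"
  let ?D = "surf_inner M (surf_grad M H) (surf_grad M H)"
  let ?B = "bdry_inner M (\<lambda>x. ?g x \<bullet> bdry_normal M x) (\<lambda>x. ?g x \<bullet> bdry_normal M x)"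
  have X: "X \<in> fe_space_vec M" and H: "H \<in> fe_space M"
    using step unfolding scheme_step_def by blast+
  have g: "?g \<in> fe_space_vec M" by (rule fe_space_vec_diff_id[OF M X])
  have cont: "continuous_on (surf M) ?g"
    using continuous_on_vec_lambda[of "surf M" "\<lambda>i x. ?g x $ i"] fe_space_vec_component[OF g]
    by (simp add: fe_space_def del: vector_minus_component)
  \<comment> \<open>First equation with the test function \<open>H\<close>.\<close>
  have "lumped_inner M (\<lambda>x. ?g x /\<^sub>R \<tau>) (\<lambda>x. H x *\<^sub>R surf_normal M x) + ?D = 0"
    using step H unfolding scheme_step_def by blast
  then have 1: "?L / \<tau> = - ?D"
    unfolding lumped_inner_swap_scale[OF M cont] by linarith
  \<comment> \<open>Second equation with the displacement as test function.\<close>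
  have "?L - surf_inner M (surf_grad_vec M X) (surf_grad_vec M ?g)
      + cos \<theta> * bdry_inner M (bdry_normal_half M X) ?g - 1 / (\<eta> * \<tau>) * ?B = 0"
    using step g unfolding scheme_step_def by blast
  then have "surf_area (image_mesh X M) - surf_area M
      \<le> ?L + cos \<theta> * (enclosed_area (image_mesh X M) - enclosed_area M) - 1 / (\<eta> * \<tau>) * ?B"
    using surf_area_image_mesh_diff_le[OF M X] unfolding bdry_inner_normal_half[OF M M' X] by linarith
  \<comment> \<open>Dividing by \<open>\<tau>\<close> turns \<open>- ?L\<close> into the dissipation
    \<open>?D\<close> and gives \<open>?B\<close> the factor that the squared boundary velocity
    carries.\<close>
  then have "(- ?L + 1 / (\<eta> * \<tau>) * ?B) / \<tau>
      \<le> ((surf_area M - cos \<theta> * enclosed_area M)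
        - (surf_area (image_mesh X M) - cos \<theta> * enclosed_area (image_mesh X M))) / \<tau>"
    using \<tau> by (intro divide_right_mono) (simp_all add: algebra_simps)
  moreover have "(bdry_norm M (\<lambda>x. (?g x /\<^sub>R \<tau>) \<bullet> bdry_normal M x))\<^sup>2 = ?B / \<tau>\<^sup>2"
    using bdry_inner_divide[of M "\<lambda>x. ?g x \<bullet> bdry_normal M x" \<tau>]
    by (simp add: bdry_norm_power2 divide_inverse mult.commute)
  then have "(surf_norm M (surf_grad M H))\<^sup>2
      + 1 / \<eta> * (bdry_norm M (\<lambda>x. (?g x /\<^sub>R \<tau>) \<bullet> bdry_normal M x))\<^sup>2
    = (- ?L + 1 / (\<eta> * \<tau>) * ?B) / \<tau>"
    using 1 by (simp only: surf_norm_power2) (simp add: diff_divide_distrib power2_eq_square)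
  ultimately show ?thesis by simp
qed

theorem theorem3p2:
  fixes \<tau> \<eta> \<theta>\<^sub>Y :: real
    and S :: "nat \<Rightarrow> mesh"
    and X :: "nat \<Rightarrow> real^3 \<Rightarrow> real^3"
    and H :: "nat \<Rightarrow> real^3 \<Rightarrow> real"
    and W :: "nat \<Rightarrow> real"
  assumes "\<tau> > 0" and "\<eta> > 0" and "0 \<le> \<theta>\<^sub>Y" and "\<theta>\<^sub>Y \<le> pi"
    and surfaces: "\<And>m. polygonal_surface (S m)"
    and solution: "\<And>m. scheme_step \<tau> \<eta> \<theta>\<^sub>Y (S m) (X (Suc m)) (H (Suc m))"
    and evolution: "\<And>m. S (Suc m) = image_mesh (X (Suc m)) (S m)"
    and W: "\<And>m. W m = surf_area (S m) - cos \<theta>\<^sub>Y * enclosed_area (S m)"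
  shows "(\<forall>m. W (Suc m) \<le> W m \<and> W m \<le> W 0) \<and>
    (\<forall>m. (\<Sum>l = 1..Suc m. (surf_norm (S (l - 1)) (surf_grad (S (l - 1)) (H l)))\<^sup>2)
          + 1 / \<eta> * (\<Sum>l = 1..Suc m.
              (bdry_norm (S (l - 1))
                (\<lambda>x. ((X l x - x) /\<^sub>R \<tau>) \<bullet> bdry_normal (S (l - 1)) x))\<^sup>2)
        \<le> (W 0 - W (Suc m)) / \<tau>)"
proof -
  \<comment> \<open>The dissipation of the step from level \<open>l - 1\<close> to level
    \<open>l\<close>; the sums start at \<open>l = 1\<close>, where the subtraction does not
    truncate.\<close>
  define d where "d l = (surf_norm (S (l - 1)) (surf_grad (S (l - 1)) (H l)))\<^sup>2
      + 1 / \<eta> * (bdry_norm (S (l - 1)) (\<lambda>x. ((X l x - x) /\<^sub>R \<tau>) \<bullet> bdry_normal (S (l - 1)) x))\<^sup>2" for l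
  have step: "d (Suc m) \<le> (W m - W (Suc m)) / \<tau>" for m
  proof -
    have "polygonal_surface (image_mesh (X (Suc m)) (S m))"
      using surfaces[of "Suc m"] by (simp add: evolution)
    from energy_step[OF assms(1) surfaces this solution] show ?thesis
      by (simp add: d_def W evolution)
  qed
  have "0 \<le> d l" for l
    using assms(2) by (simp add: d_def)
  then have "0 \<le> (W m - W (Suc m)) / \<tau>" for m
    using step order_trans by blast
  then have dec: "W (Suc m) \<le> W m" for m
    using assms(1) by (simp add: zero_le_divide_iff not_le)
  have "W m \<le> W 0" for m
    using lift_Suc_antimono_le[of W 0 m] dec by simp
  \<comment> \<open>The bounds for the single steps telescope.\<close>
  moreover have "(\<Sum>l = 1..Suc m. d l) \<le> (W 0 - W (Suc m)) / \<tau>" for m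
  proof (induction m)
    case 0
    then show ?case using step[of 0] by simp
  next
    case (Suc m)
    have "(W 0 - W (Suc m)) / \<tau> + (W (Suc m) - W (Suc (Suc m))) / \<tau> = (W 0 - W (Suc (Suc m))) / \<tau>"
      by (simp flip: add_divide_distrib)
    then show ?case using Suc step[of "Suc m"] by simp
  qed
  ultimately show ?thesis
    using dec by (simp only: d_def sum.distrib sum_distrib_left simp_thms)
qed

end
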